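(* Let $F=\mathbb{F}_q$ with $q$ a prime power, let $L$ be an extension of $F$ of prime degree $r$, and let $\sigma$ be a generator of $\mathrm{Gal}(L/F)$. If $r$ does not divide $q-1$ then for all $a\in L\setminus F$, $$\mathrm{Aut}((L/F,\sigma,a))\cong\mathbb{Z}/s\mathbb{Z},\qquad s=\frac{q^r-1}{q-1}.$$
   Context: For a cyclic Galois field extension $L/F$ of degree $n$ with Galois group generated by $\sigma$ and $a\in L\setminus F$, the nonassociative cyclic algebra $(L/F,\sigma,a)$ is the $L$-vector space $\bigoplus_{i=0}^{n-1}Lz^i$ with basis of formal symbols $z^0=1,z,\dots,z^{n-1}$ and multiplication defined, for $l,m\in L$ and $0\le i,j<n$, by $(lz^i)(mz^j)=l\sigma^i(m)z^{i+j}$ if $i+j<n$ and $(lz^i)(mz^j)=l\sigma^i(m)a\,z^{i+j-n}$ if $i+j\ge n$, extended additively in both arguments. $\mathrm{Aut}$ denotes the group of $F$-algebra automorphisms. *)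

theory Defs
  imports "HOL-Algebra.Algebra" "HOL-Number_Theory.Prime_Powers"
begin

text \<open>Automorphisms are taken extensional (undefined off the carrier), as in
  \<^const>\<open>Bij\<close>, so that each one is represented by exactly one HOL function. The group
  operation is composition.\<close>

definition galois_group :: "('a, 'b) ring_scheme \<Rightarrow> 'a set \<Rightarrow> ('a \<Rightarrow> 'a) monoid"
  where "galois_group L F =
    (BijGroup (carrier L))
      \<lparr>carrier := {f \<in> Bij (carrier L). f \<in> ring_iso L L \<and> (\<forall>c \<in> F. f c = c)}\<rparr>"

text \<open>The record type \<^typ>\<open>('a, 'b) module\<close> only supplies the operations; \<open>A\<close> need not be
  associative. The scalars of \<open>A\<close> may form a larger set than \<open>F\<close>: only \<open>F\<close>-linearity is
  required.\<close>

definition alg_aut_group :: "'a set \<Rightarrow> ('a, 'b) module \<Rightarrow> ('b \<Rightarrow> 'b) monoid"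
  where "alg_aut_group F A =
    (BijGroup (carrier A))
      \<lparr>carrier := {f \<in> Bij (carrier A). f \<in> ring_iso A A \<and>
         (\<forall>c \<in> F. \<forall>x \<in> carrier A. f (c \<odot>\<^bsub>A\<^esub> x) = c \<odot>\<^bsub>A\<^esub> f x)}\<rparr>"

text \<open>The sum of all \<open>x\<^sub>i z\<^sup>i\<close> with \<open>i < n\<close> is represented by its coefficient function \<open>x\<close> on
  \<open>{..<n}\<close>; \<open>nca_monom L n l k\<close> is the element \<open>l z\<^sup>k\<close>.\<close>

definition nca_monom :: "('a, 'b) ring_scheme \<Rightarrow> nat \<Rightarrow> 'a \<Rightarrow> nat \<Rightarrow> (nat \<Rightarrow> 'a)"
  where "nca_monom L n l k = (\<lambda>i\<in>{..<n}. if i = k then l else \<zero>\<^bsub>L\<^esub>)"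

definition nca_monom_mult ::
    "('a, 'b) ring_scheme \<Rightarrow> nat \<Rightarrow> ('a \<Rightarrow> 'a) \<Rightarrow> 'a \<Rightarrow> 'a \<Rightarrow> nat \<Rightarrow> 'a \<Rightarrow> nat \<Rightarrow> (nat \<Rightarrow> 'a)"
  where "nca_monom_mult L n \<sigma> a l i m j =
    (if i + j < n
     then nca_monom L n (l \<otimes>\<^bsub>L\<^esub> (\<sigma> ^^ i) m) (i + j)
     else nca_monom L n (l \<otimes>\<^bsub>L\<^esub> (\<sigma> ^^ i) m \<otimes>\<^bsub>L\<^esub> a) (i + j - n))"

text \<open>The nonassociative cyclic algebra \<open>(L/F,\<sigma>,a)\<close>, meaningful when \<open>L/F\<close> is cyclic Galois with
  group generated by \<open>\<sigma>\<close> and \<open>a \<in> L - F\<close>. Its product is the biadditive extension of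
  \<^const>\<open>nca_monom_mult\<close>; scalars from \<open>L\<close> act on the left.\<close>

definition nonassoc_cyclic_algebra ::
    "('a, 'b) ring_scheme \<Rightarrow> 'a set \<Rightarrow> ('a \<Rightarrow> 'a) \<Rightarrow> 'a \<Rightarrow> ('a, nat \<Rightarrow> 'a) module"
  where "nonassoc_cyclic_algebra L F \<sigma> a =
    (let n = ring.dim L F (carrier L) in
     \<lparr>carrier = {..<n} \<rightarrow>\<^sub>E carrier L,
      monoid.mult = (\<lambda>x y. \<lambda>k\<in>{..<n}.
        \<Oplus>\<^bsub>L\<^esub>i\<in>{..<n}. \<Oplus>\<^bsub>L\<^esub>j\<in>{..<n}. nca_monom_mult L n \<sigma> a (x i) i (y j) j k),
      monoid.one = nca_monom L n \<one>\<^bsub>L\<^esub> 0,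
      ring.zero = (\<lambda>k\<in>{..<n}. \<zero>\<^bsub>L\<^esub>),
      ring.add = (\<lambda>x y. \<lambda>k\<in>{..<n}. x k \<oplus>\<^bsub>L\<^esub> y k),
      module.smult = (\<lambda>c x. \<lambda>k\<in>{..<n}. c \<otimes>\<^bsub>L\<^esub> x k)\<rparr>)"

end

theory Submission
  imports Defs "HOL-Number_Theory.Cong"
begin

text \<open>
  Every \<open>F\<close>-automorphism of \<open>L\<close> is a power of the Frobenius map \<open>x \<mapsto> x\<^sup>q\<close>, and hence
  \<open>N(k) = \<Prod>\<^sub>i \<sigma>\<^sup>i(k) = k\<^sup>s\<close>. Testing associativity on \<open>z \<cdot> z\<^sup>r\<^sup>-\<^sup>1 = a\<close> shows that the left nucleus of
  the algebra is \<open>L z\<^sup>0\<close>. An automorphism \<open>H\<close> therefore restricts to an \<open>F\<close>-automorphism \<open>\<tau>\<close> of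
  \<open>L\<close>, the relations \<open>z l = \<sigma>(l) z\<close> force \<open>H(z) = k z\<close>, and applying \<open>H\<close> to \<open>z \<cdot> z\<^sup>r\<^sup>-\<^sup>1 = a\<close> gives
  \<open>\<tau>(a) = N(k) a\<close>. Iterating \<open>\<tau>\<close> yields \<open>N(k)\<^sup>r = 1\<close>; as also \<open>N(k)\<^sup>q\<^sup>-\<^sup>1 = 1\<close> and \<open>r\<close> is prime to
  \<open>q - 1\<close>, \<open>N(k) = 1\<close>. So \<open>\<tau>\<close> fixes \<open>a \<notin> F\<close> and is the identity. Conversely each \<open>k\<close> with
  \<open>k\<^sup>s = 1\<close> defines an automorphism, and these \<open>k\<close> form the subgroup of order \<open>s\<close> of the cyclic
  group of units of \<open>L\<close>.
\<close>

section \<open>The Frobenius map\<close>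

text \<open>Induction by Pascal's rule: the products of the sum with \<open>x\<close> and with
  \<open>y\<close> are re-indexed to the common terms
  \<open>x [^] Suc k \<otimes> y [^] (n - k)\<close>.\<close>

lemma (in cring) binomial:
  assumes "x \<in> carrier R" "y \<in> carrier R"
  shows "(x \<oplus> y) [^] n = (\<Oplus>k\<in>{..n}. add_pow R (n choose k) (x [^] k \<otimes> y [^] (n - k)))"
proof (induction n)
  case 0
  then show ?case using assms by simp
next
  case (Suc n)
  let ?S = "\<Oplus>k\<in>{..n}. add_pow R (n choose k) (x [^] k \<otimes> y [^] (n - k))"
  let ?t = "\<lambda>k. x [^] Suc k \<otimes> y [^] (n - k)"
  have S: "?S \<in> carrier R" using assms by (intro finsum_closed) auto
  have xS: "x \<otimes> ?S = (\<Oplus>k\<in>{..n}. add_pow R (n choose k) (?t k))"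
    using assms
    by (subst finsum_rdistr)
      (auto intro!: finsum_cong' simp: add_pow_rdistr m_assoc[symmetric] m_comm[of x])
  have "y \<otimes> ?S = (\<Oplus>k\<in>{..n}. add_pow R (n choose k) (x [^] k \<otimes> y [^] (Suc n - k)))"
    using assms
    by (subst finsum_rdistr)
      (auto intro!: finsum_cong' simp: add_pow_rdistr Suc_diff_le m_comm[of y] m_assoc)
  \<comment> \<open>The term added at \<open>k = Suc n\<close> is zero because
    \<open>n choose Suc n = 0\<close>; splitting off \<open>k = 0\<close> next then leaves the range
    \<open>{..n}\<close>.\<close>
  also have "\<dots> = (\<Oplus>k\<in>{..Suc n}. add_pow R (n choose k) (x [^] k \<otimes> y [^] (Suc n - k)))"
    using assms by (subst finsum_Suc) (auto simp: binomial_eq_0)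
  also have "\<dots> = (\<Oplus>k\<in>{..n}. add_pow R (n choose Suc k) (?t k)) \<oplus> y [^] Suc n"
    using assms by (subst finsum_Suc2) auto
  finally have yS: "y \<otimes> ?S = (\<Oplus>k\<in>{..n}. add_pow R (n choose Suc k) (?t k)) \<oplus> y [^] Suc n" .
  have "(\<Oplus>k\<in>{..Suc n}. add_pow R (Suc n choose k) (x [^] k \<otimes> y [^] (Suc n - k)))
      = (\<Oplus>k\<in>{..n}. add_pow R (Suc n choose Suc k) (?t k)) \<oplus> y [^] Suc n"
    using assms by (subst finsum_Suc2) auto
  also have "(\<Oplus>k\<in>{..n}. add_pow R (Suc n choose Suc k) (?t k))
      = (\<Oplus>k\<in>{..n}. add_pow R (n choose k) (?t k) \<oplus> add_pow R (n choose Suc k) (?t k))"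
    using assms by (auto intro!: finsum_cong' simp: add.nat_pow_mult simp del: nat_pow_Suc)
  also have "\<dots> = (\<Oplus>k\<in>{..n}. add_pow R (n choose k) (?t k)) \<oplus> (\<Oplus>k\<in>{..n}. add_pow R (n choose Suc k) (?t k))"
    using assms by (subst finsum_addf) auto
  finally have "(\<Oplus>k\<in>{..Suc n}. add_pow R (Suc n choose k) (x [^] k \<otimes> y [^] (Suc n - k)))
      = x \<otimes> ?S \<oplus> y \<otimes> ?S"
    unfolding xS yS using assms
    by (subst a_assoc[symmetric]) (auto intro!: finsum_closed simp del: nat_pow_Suc)
  moreover have "(x \<oplus> y) [^] Suc n = x \<otimes> ?S \<oplus> y \<otimes> ?S"
    using assms S by (simp only: nat_pow_Suc Suc.IH l_distr m_comm[OF S] a_closed)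
  ultimately show ?case by (simp only:)
qed

text \<open>The prime \<open>p\<close> divides every binomial coefficient except the two outer ones,
  so all inner terms are multiples of \<open>add_pow R p \<one> = \<zero>\<close>.\<close>

lemma (in cring) frobenius_add:
  assumes p: "Factorial_Ring.prime (p::nat)" and char: "add_pow R p \<one> = \<zero>"
    and x: "x \<in> carrier R" and y: "y \<in> carrier R"
  shows "(x \<oplus> y) [^] p = x [^] p \<oplus> y [^] p"
proof -
  have p_smult: "add_pow R (p * m) z = \<zero>" if z: "z \<in> carrier R" for m z
  proof -
    have "add_pow R p z = (add_pow R p \<one>) \<otimes> z" using z by (subst add_pow_ldistr) auto
    then have "add_pow R p z = \<zero>" using char z by simp
    then show ?thesis using z by (metis add.nat_pow_one add.nat_pow_pow)
  qed
  \<comment> \<open>A prime is at least 2; in this form both end terms of the sum can be split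
    off.\<close>
  obtain n where n: "p = Suc (Suc n)"
    using prime_gt_1_nat[OF p] by (auto dest!: less_imp_Suc_add)
  let ?f = "\<lambda>k. add_pow R (p choose k) (x [^] k \<otimes> y [^] (p - k))"
  have f: "?f k \<in> carrier R" for k using x y by simp
  have z: "?f (Suc k) = \<zero>" if "k \<le> n" for k
  proof -
    have "p dvd p choose Suc k"
      by (rule dvd_choose_prime) (use that p n in auto)
    then obtain m where "p choose Suc k = p * m" by blast
    then show ?thesis using p_smult x y by simp
  qed
  have "(x \<oplus> y) [^] p = (\<Oplus>k\<in>{..Suc (Suc n)}. ?f k)"
    using binomial[OF x y, of p] n by simp
  also have "\<dots> = ?f (Suc (Suc n)) \<oplus> ((\<Oplus>k\<in>{..n}. ?f (Suc k)) \<oplus> ?f 0)"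
    using f by (subst finsum_Suc, blast, subst finsum_Suc2) auto
  also have "(\<Oplus>k\<in>{..n}. ?f (Suc k)) = (\<Oplus>k\<in>{..n}. \<zero>)"
    using z by (intro finsum_cong') auto
  finally show ?thesis using x y by (simp flip: n)
qed

lemma (in cring) frobenius_power_add:
  assumes "Factorial_Ring.prime (p::nat)" and "add_pow R p \<one> = \<zero>"
    and "x \<in> carrier R" and "y \<in> carrier R"
  shows "(x \<oplus> y) [^] (p ^ n) = x [^] (p ^ n) \<oplus> y [^] (p ^ n)"
proof (induction n)
  case (Suc n)
  have pw: "z [^] (p ^ Suc n) = (z [^] (p ^ n)) [^] p" if "z \<in> carrier R" for z
    using nat_pow_pow[OF that, of "p ^ n" p] by (simp only: power_Suc2)
  have "(x \<oplus> y) [^] (p ^ Suc n) = (x [^] (p ^ n) \<oplus> y [^] (p ^ n)) [^] p"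
    by (simp only: pw[OF a_closed[OF assms(3,4)]] Suc.IH)
  also have "\<dots> = x [^] (p ^ Suc n) \<oplus> y [^] (p ^ Suc n)"
    by (simp only: pw[OF assms(3)] pw[OF assms(4)]
        frobenius_add[OF assms(1,2) nat_pow_closed[OF assms(3)] nat_pow_closed[OF assms(4)]])
  finally show ?case .
qed (simp add: assms(3,4))

text \<open>Each dimension step adjoins a vector \<open>v\<close> outside \<open>E'\<close>; then
  \<open>(k, w)\<close> is determined by \<open>k \<otimes> v \<oplus> w\<close>, so the cardinality
  grows by the factor \<open>card K\<close>.\<close>

lemma (in ring) card_dimension:
  assumes K: "subfield K R" and "dimension n K E" and "finite K"
  shows "finite E \<and> card E = card K ^ n"
  using assms(2)
proof (induction n arbitrary: E)
  case 0
  from dimension_zero[OF K 0] show ?case by simp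
next
  case (Suc n)
  then obtain v E' where v: "v \<in> carrier R" "v \<notin> E'" and E': "dimension n K E'"
    and E: "E = line_extension K v E'"
    using dimension_backwards[OF K] by blast
  note sub = space_subgroup_props[OF K E']
  have IH: "finite E'" "card E' = card K ^ n" using Suc.IH[OF E'] by auto
  have KR: "K \<subseteq> carrier R" by (rule subfieldE(3)[OF K])
  have img: "E = (\<lambda>(k, w). k \<otimes> v \<oplus> w) ` (K \<times> E')"
    unfolding E by (auto simp: line_extension_mem_iff image_iff) blast
  have "inj_on (\<lambda>(k, w). k \<otimes> v \<oplus> w) (K \<times> E')"
  proof (rule inj_onI, clarify)
    fix k w k' w'
    assume k: "k \<in> K" "k' \<in> K" and w: "w \<in> E'" "w' \<in> E'"
      and eq: "k \<otimes> v \<oplus> w = k' \<otimes> v \<oplus> w'"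
    have c: "k \<in> carrier R" "k' \<in> carrier R" "w \<in> carrier R" "w' \<in> carrier R"
      using k w KR sub(1) by auto
    have "(k \<ominus> k') \<otimes> v = w' \<ominus> w"
    proof -
      have "(k \<ominus> k') \<otimes> v = (k \<otimes> v \<oplus> w) \<ominus> w \<ominus> k' \<otimes> v"
        using c v by algebra
      also have "\<dots> = w' \<ominus> w" unfolding eq using c v by algebra
      finally show ?thesis .
    qed
    then have in_E': "(k \<ominus> k') \<otimes> v \<in> E'"
      using w sub(3,4) by (simp add: a_minus_def)
    \<comment> \<open>A nonzero \<open>k \<ominus> k'\<close> would be invertible in
      \<open>K\<close> and would force \<open>v\<close> into \<open>E'\<close>.\<close>
    have "k \<ominus> k' \<in> K"
      using k subringE(5,7)[OF subfieldE(1)[OF K]] by (simp add: a_minus_def)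
    then have "k \<ominus> k' = \<zero>"
      using sub(6)[of "k \<ominus> k'" v] in_E' v by blast
    then have "k = k'" using c by (simp add: r_right_minus_eq)
    then show "k = k' \<and> w = w'" using eq c v by simp
  qed
  then have "card E = card (K \<times> E')" unfolding img by (rule card_image)
  moreover have "finite E" unfolding img using assms(3) IH by simp
  ultimately show ?case using IH by (simp add: card_cartesian_product)
qed

section \<open>Automorphisms of extensions of finite fields\<close>

lemma geometric_sum_nat: "(q - 1) * (\<Sum>i<n. q ^ i) = q ^ n - (1::nat)"
proof (cases q)
  case (Suc p)
  have "p * (\<Sum>i<n. Suc p ^ i) + 1 = Suc p ^ n"
    by (induction n) (auto simp: algebra_simps)
  then show ?thesis using Suc by simp
qed (cases n; simp)

text \<open>The unit group is cyclic, and the order of a generator is the size of the subgroup it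
  generates. The rewrites turn group powers and the group unit into those of \<open>R\<close>, so
  that later arguments only compute with exponents.\<close>

lemma (in field) finite_mult_generator:
  assumes "finite (carrier R)"
  obtains g where "g \<in> carrier R - {\<zero>}"
    and "\<And>x. x \<in> carrier R - {\<zero>} \<Longrightarrow> \<exists>i::nat. x = g [^] i"
    and "\<And>n::nat. g [^] n = \<one> \<longleftrightarrow> (card (carrier R) - 1) dvd n"
proof -
  let ?M = "Multiplicative_Group.mult_of R"
  interpret G: group ?M rewrites
      "([^]\<^bsub>?M\<^esub>) = (([^]) :: _ \<Rightarrow> nat \<Rightarrow> _)" and "\<one>\<^bsub>?M\<^esub> = \<one>"
      and "carrier ?M = carrier R - {\<zero>}"
    by (rule field_mult_group) (simp_all add: fun_eq_iff nat_pow_def)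
  obtain g where g: "g \<in> carrier R - {\<zero>}" and "carrier R - {\<zero>} = {g [^] i | i::nat. i \<in> UNIV}"
    using finite_field_mult_group_has_gen[OF assms] by auto
  then have gen: "carrier R - {\<zero>} = range (\<lambda>i::nat. g [^] i)"
    by (simp add: full_SetCompr_eq)
  have fin: "finite (carrier R - {\<zero>})" using assms by simp
  have "generate ?M {g} = range (\<lambda>i::nat. g [^] i)"
    using G.generate_pow_on_finite_carrier[OF fin g] by (auto simp: full_SetCompr_eq)
  then have "G.ord g = card (carrier R) - 1"
    using G.generate_pow_card[OF g] assms by (simp flip: gen)
  then show ?thesis using that g gen G.pow_eq_id[OF g] by auto
qed

lemma (in field) finite_pow_card:
  assumes "finite (carrier R)" and "x \<in> carrier R - {\<zero>}"
  shows "x [^] (card (carrier R) - 1) = \<one>"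
proof -
  let ?M = "Multiplicative_Group.mult_of R"
  interpret G: group ?M rewrites
      "([^]\<^bsub>?M\<^esub>) = (([^]) :: _ \<Rightarrow> nat \<Rightarrow> _)" and "\<one>\<^bsub>?M\<^esub> = \<one>"
      and "carrier ?M = carrier R - {\<zero>}"
    by (rule field_mult_group) (simp_all add: fun_eq_iff nat_pow_def)
  show ?thesis
    using G.pow_order_eq_1[of x] assms by (simp add: order_def)
qed

lemma (in field) subfield_pow_card:
  assumes F: "subfield F R" and fin: "finite F" and x: "x \<in> F - {\<zero>}"
  shows "x [^] (card F - 1) = \<one>"
proof -
  interpret F: field "R\<lparr>carrier := F\<rparr>" by (rule subfield_iff(2)[OF F])
  show ?thesis
    using F.finite_pow_card[of x] fin x nat_pow_consistent[of x _ F] by simp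
qed

section \<open>Powers of the q-Frobenius on an extension of degree r\<close>

locale finite_field_ext = field L for L (structure) +
  fixes F :: "'a set" and q r :: nat
  assumes F: "subfield F L" and q: "primepow q" and card_F: "card F = q"
    and dim: "dimension r F (carrier L)" and r: "r > 1"
begin

lemma q_gt_1: "q > 1"
  using primepow_gt_Suc_0[OF q] by simp

lemma finite_F: "finite F"
  using card_F q_gt_1 by (metis card.infinite not_less_zero)

lemma F_subset: "F \<subseteq> carrier L"
  by (rule subfieldE(3)[OF F])

lemma finite_L: "finite (carrier L)" and card_L: "card (carrier L) = q ^ r"
  using card_dimension[OF F dim finite_F] card_F by auto

lemma one_less_q_power: "q ^ i > 1" if "i > 0" for i
  by (rule one_less_power[OF q_gt_1 that])

lemma pow_card_minus: "x \<in> carrier L - {\<zero>} \<Longrightarrow> x [^] (q ^ r - 1) = \<one>"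
  using finite_pow_card[OF finite_L] card_L by simp

lemma pow_card [simp]:
  assumes "x \<in> carrier L" shows "x [^] (q ^ r) = x"
proof (cases "x = \<zero>")
  case False
  have "x [^] (q ^ r) = x [^] Suc (q ^ r - 1)" using q_gt_1 by simp
  also have "\<dots> = x" using pow_card_minus[of x] assms False by simp
  finally show ?thesis .
qed (use q_gt_1 r in \<open>simp add: nat_pow_zero\<close>)

lemma frob_frob: "x \<in> carrier L \<Longrightarrow> (x [^] (q ^ i)) [^] (q ^ j) = x [^] (q ^ (i + j))"
  by (simp add: nat_pow_pow power_add)

lemma frob_mult_period: "x \<in> carrier L \<Longrightarrow> x [^] (q ^ i) = x \<Longrightarrow> x [^] (q ^ (i * n)) = x"
  by (induction n) (simp_all add: frob_frob[symmetric])

lemma frob_mod: "x \<in> carrier L \<Longrightarrow> x [^] (q ^ (i mod r)) = x [^] (q ^ i)"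
proof -
  assume x: "x \<in> carrier L"
  have "x [^] (q ^ i) = x [^] (q ^ (r * (i div r) + i mod r))" by simp
  also have "\<dots> = x [^] (q ^ (i mod r))"
    using x frob_mult_period[of x r "i div r"] frob_frob[symmetric, of x "r * (i div r)" "i mod r"]
    by simp
  finally show ?thesis by simp
qed

text \<open>The characteristic of \<open>L\<close> is the prime \<open>p\<close> with
  \<open>q = p ^ k\<close>: the additive group has order \<open>p ^ (k * r)\<close>, so
  \<open>add_pow L p \<one>\<close> is nilpotent and hence zero in a field.\<close>

lemma frob_add:
  assumes "x \<in> carrier L" "y \<in> carrier L"
  shows "(x \<oplus> y) [^] (q ^ i) = x [^] (q ^ i) \<oplus> y [^] (q ^ i)"
proof -
  obtain p k where p: "Factorial_Ring.prime p" and qk: "q = p ^ k"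
    using q by (auto simp: primepow_def)
  have pow: "add_pow L (p ^ n) \<one> = (add_pow L p \<one>) [^] n" for n
  proof (induction n)
    case (Suc n)
    have "add_pow L (p ^ Suc n) \<one> = add_pow L p (add_pow L (p ^ n) \<one>)"
      by (simp add: add.nat_pow_pow mult.commute)
    also have "\<dots> = add_pow L (p ^ n) \<one> \<otimes> add_pow L p \<one>"
      by (simp add: add_pow_rdistr)
    finally show ?case using Suc by simp
  qed simp
  have zero_pow: "u = \<zero>" if "u [^] n = \<zero>" "u \<in> carrier L" for u and n :: nat
    using that by (induction n) (auto dest: integral)
  have "add_pow L (p ^ (k * r)) \<one> = \<zero>"
    using add.pow_order_eq_1[of \<one>] card_L
    by (simp add: order_def qk power_mult)
  then have "add_pow L p \<one> = \<zero>"
    using zero_pow[of "add_pow L p \<one>"] unfolding pow by simp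
  then show ?thesis
    using frobenius_power_add[OF p _ assms, of "k * i"] by (simp add: qk power_mult)
qed

text \<open>By Lagrange the units of \<open>F\<close> solve \<open>x [^] (q - 1) = \<one>\<close>,
  and the cyclic unit group of \<open>L\<close> has at most \<open>q - 1\<close> solutions; counting
  shows that \<open>F\<close> contains them all.\<close>

lemma subfield_eq_frob_fixed: "F = {x \<in> carrier L. x [^] q = x}"
proof -
  obtain g where g: "g \<in> carrier L - {\<zero>}"
    and gen: "\<And>x. x \<in> carrier L - {\<zero>} \<Longrightarrow> \<exists>i::nat. x = g [^] i"
    and ord: "\<And>n::nat. g [^] n = \<one> \<longleftrightarrow> (q ^ r - 1) dvd n"
    using finite_mult_generator[OF finite_L] card_L by metis
  let ?R = "{x \<in> carrier L - {\<zero>}. x [^] (q - 1) = \<one>}"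
  \<comment> \<open>\<open>s\<close> is the cofactor of \<open>q - 1\<close> in the order of
    \<open>g\<close>; every solution turns out to be a power of \<open>g [^] s\<close>.\<close>
  obtain s where s: "q ^ r - 1 = s * (q - 1)"
    using geometric_sum_nat[of q r] by (metis mult.commute)
  have s0: "s > 0" using s one_less_q_power[of r] r by (cases s) auto
  have "?R \<subseteq> (\<lambda>j. g [^] (s * j)) ` {..<q - 1}"
  proof
    fix x assume x: "x \<in> ?R"
    then obtain i where i: "x = g [^] (i::nat)" using gen[of x] by auto
    have "g [^] (i * (q - 1)) = \<one>" using x g i by (simp add: nat_pow_pow)
    \<comment> \<open>The order \<open>s * (q - 1)\<close> of \<open>g\<close> divides
      \<open>i * (q - 1)\<close>, and \<open>q - 1\<close> cancels.\<close>
    then have "s dvd i" using ord s q_gt_1 by simp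
    then obtain j where j: "i = s * j" by blast
    have "(g [^] (s * (q - 1))) = \<one>" using ord s by simp
    have "s * j = s * (j mod (q - 1)) + s * (q - 1) * (j div (q - 1))"
      by (metis add.commute distrib_left mult.assoc mult_div_mod_eq)
    then have "x = g [^] (s * (j mod (q - 1)) + s * (q - 1) * (j div (q - 1)))"
      using i j by simp
    also have "\<dots> = g [^] (s * (j mod (q - 1))) \<otimes> (g [^] (s * (q - 1))) [^] (j div (q - 1))"
      using g by (simp add: nat_pow_pow nat_pow_mult)
    also have "\<dots> = g [^] (s * (j mod (q - 1)))"
      using g \<open>(g [^] (s * (q - 1))) = \<one>\<close> by simp
    finally show "x \<in> (\<lambda>j. g [^] (s * j)) ` {..<q - 1}" using q_gt_1 by auto
  qed
  then have "card ?R \<le> q - 1"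
    by (metis (no_types, lifting) card_image_le card_lessThan card_mono finite_imageI finite_lessThan le_trans)
  moreover have sub: "F - {\<zero>} \<subseteq> ?R"
    using subfield_pow_card[OF F finite_F] F_subset card_F by auto
  moreover have "card (F - {\<zero>}) = q - 1"
    using card_F finite_F subringE(2)[OF subfieldE(1)[OF F]] by simp
  moreover have "finite ?R" using finite_L by simp
  ultimately have eq: "F - {\<zero>} = ?R"
    by (metis card_mono card_subset_eq le_antisym)
  have "x [^] q = x \<longleftrightarrow> x [^] (q - 1) = \<one>" if "x \<in> carrier L - {\<zero>}" for x
  proof -
    have "x [^] q = x [^] (q - 1) \<otimes> x" using q_gt_1 that
      by (metis One_nat_def Suc_diff_Suc minus_nat.diff_0 nat_pow_Suc zero_less_one less_trans)
    then show ?thesis using that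
      by (metis DiffE insertI1 l_one m_rcancel nat_pow_closed one_closed)
  qed
  moreover have "\<zero> \<in> F" using subringE(2)[OF subfieldE(1)[OF F]] .
  moreover have "\<zero> [^] q = \<zero>" using q_gt_1 by (simp add: nat_pow_zero)
  ultimately show ?thesis using eq F_subset by blast
qed

lemma frob_fixes_F: "c \<in> F \<Longrightarrow> c [^] (q ^ i) = c"
  using frob_mult_period[of c 1 i] subfield_eq_frob_fixed by auto

lemma frob_hom: "(\<lambda>x. x [^] (q ^ i)) \<in> ring_hom L L"
  by (rule ring_hom_memI) (auto simp: nat_pow_distrib frob_add)

text \<open>Raising to the power \<open>q ^ ((r - 1) * i)\<close> afterwards gives
  \<open>q ^ (r * i)\<close> in total, which is the identity.\<close>

lemma frob_inj: "x \<in> carrier L \<Longrightarrow> y \<in> carrier L \<Longrightarrow> x [^] (q ^ i) = y [^] (q ^ i) \<Longrightarrow> x = y"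
proof -
  assume x: "x \<in> carrier L" and y: "y \<in> carrier L" and eq: "x [^] (q ^ i) = y [^] (q ^ i)"
  have "z [^] (q ^ (i + (r - 1) * i)) = z" if "z \<in> carrier L" for z
  proof -
    have "i + (r - 1) * i = r * i" using r by (cases r) auto
    then show ?thesis using frob_mult_period[OF that, of r i] that by simp
  qed
  then show "x = y" using arg_cong[OF eq, of "\<lambda>z. z [^] (q ^ ((r - 1) * i))"] x y
    by (simp add: frob_frob)
qed

text \<open>For a generator \<open>g\<close> of the units, \<open>L = F(g)\<close>, and the minimal
  polynomial of \<open>g\<close> has degree \<open>r\<close>. Every homomorphism fixing
  \<open>F\<close> sends \<open>g\<close> to a root of it, and the conjugates
  \<open>g [^] (q ^ i)\<close> are all the roots. The value at \<open>g\<close> determines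
  \<open>h\<close>.\<close>

lemma hom_eq_frob:
  assumes h: "h \<in> ring_hom L L" and fix_F: "\<And>c. c \<in> F \<Longrightarrow> h c = c"
  obtains m where "m < r" and "\<And>x. x \<in> carrier L \<Longrightarrow> h x = x [^] (q ^ m)"
proof -
  obtain g where g: "g \<in> carrier L - {\<zero>}"
    and gen: "\<And>x. x \<in> carrier L - {\<zero>} \<Longrightarrow> \<exists>i::nat. x = g [^] i"
    and ord: "\<And>n::nat. g [^] n = \<one> \<longleftrightarrow> (q ^ r - 1) dvd n"
    using finite_mult_generator[OF finite_L] card_L by metis
  have gL: "g \<in> carrier L" using g by simp
  have alg: "(algebraic over F) g"
    by (rule finite_dimension_imp_algebraic[OF F carrier_is_subring _ gL])
      (use dim in \<open>auto simp: finite_dimension_def\<close>)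
  define P where "P = Irr F g"
  note P = IrrE[OF F gL alg, folded P_def]
  have subring: "subring (simple_extension F g) L"
    by (rule simple_extension_is_subring[OF subfieldE(1)[OF F] gL])
  have "g [^] (i::nat) \<in> simple_extension F g" for i
    by (induction i) (auto intro: subringE[OF subring]
        simple_extension_mem[OF subfieldE(1)[OF F] gL])
  \<comment> \<open>Powers of \<open>g\<close> exhaust the nonzero elements.\<close>
  then have "simple_extension F g = carrier L"
    using gen subringE(1,2)[OF subring] by blast
  then have deg: "degree P = r"
    using dimension_simple_extension[OF F gL alg] dimension_is_inj[OF F dim] P_def by auto
  have PL: "P \<in> carrier (poly_ring L)"
    using carrier_polynomial_shell[OF subfieldE(1)[OF F] P(1)] .
  have set_P: "set P \<subseteq> F"
    using P(1) polynomial_incl unfolding sym[OF univ_poly_carrier] by blast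
  have P_ne: "P \<noteq> []" using deg r by auto
  have root: "f g \<in># roots P" if f: "f \<in> ring_hom L L" "\<And>c. c \<in> F \<Longrightarrow> f c = c" for f
  proof -
    interpret f: ring_hom_ring L L f
      by (rule ring_hom_ringI2[OF ring_axioms ring_axioms f(1)])
    have "map f P = P" using set_P f(2) by (intro map_idI) auto
    then have "eval P (f g) = \<zero>"
      using f.eval_hom'[OF gL, of P] set_P F_subset P(4) by auto
    then show ?thesis
      using roots_mem_iff_is_root[OF PL] P_ne gL by (simp add: is_root_def)
  qed
  let ?C = "(\<lambda>i. g [^] (q ^ i)) ` {..<r}"
  have "inj_on (\<lambda>i. g [^] (q ^ i)) {..<r}"
  proof (rule linorder_inj_onI)
    fix i j assume ij: "i < j" "i \<in> {..<r}" "j \<in> {..<r}"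
    show "g [^] (q ^ i) \<noteq> g [^] (q ^ j)"
    proof
      assume "g [^] (q ^ i) = g [^] (q ^ j)"
      then have "g [^] (q ^ i) = (g [^] (q ^ (j - i))) [^] (q ^ i)"
        using gL ij by (simp add: frob_frob)
      then have "g = g [^] (q ^ (j - i))" using gL by (metis frob_inj nat_pow_closed)
      also have "\<dots> = g [^] (q ^ (j - i) - 1) \<otimes> g"
        using q_gt_1 by (metis Suc_diff_1 nat_pow_Suc zero_less_power less_trans zero_less_one)
      finally have "g [^] (q ^ (j - i) - 1) = \<one>"
        using g by (metis DiffE insertI1 l_one m_rcancel nat_pow_closed one_closed)
      \<comment> \<open>The order of \<open>g\<close> would divide a positive number that is
        smaller, because \<open>j - i < r\<close>.\<close>
      then have "q ^ r - 1 dvd q ^ (j - i) - 1" using ord by simp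
      moreover have "0 < q ^ (j - i) - 1" using one_less_q_power[of "j - i"] ij by simp
      ultimately have "q ^ r - 1 \<le> q ^ (j - i) - 1" by (rule dvd_imp_le)
      moreover have "q ^ (j - i) < q ^ r" using q_gt_1 ij by (intro power_strict_increasing) auto
      moreover have "q ^ (j - i) > 1" using one_less_q_power[of "j - i"] ij by simp
      ultimately show False by linarith
    qed
  qed auto
  then have "card ?C = r" by (simp add: card_image)
  moreover have sub: "?C \<subseteq> set_mset (roots P)" using root[OF frob_hom frob_fixes_F] by auto
  moreover have "card (set_mset (roots P)) \<le> r"
    using size_roots_le_degree[OF PL] deg
    by (metis mset_set_set_mset_msubset size_mset_mono size_mset_set le_trans)
  \<comment> \<open>The \<open>r\<close> distinct conjugates exhaust the at most \<open>r\<close>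
    roots.\<close>
  ultimately have "?C = set_mset (roots P)"
    by (metis card_mono card_subset_eq finite_set_mset le_antisym)
  then obtain m where m: "m < r" "h g = g [^] (q ^ m)"
    using root[OF h fix_F] by auto
  have "h x = x [^] (q ^ m)" if x: "x \<in> carrier L" for x
  proof (cases "x = \<zero>")
    case True
    then show ?thesis using ring_hom_zero[OF h ring_axioms ring_axioms] q_gt_1
      by (simp add: nat_pow_zero)
  next
    case False
    then obtain i where i: "x = g [^] (i::nat)" using gen x by blast
    interpret h: ring_hom_ring L L h
      by (rule ring_hom_ringI2[OF ring_axioms ring_axioms h])
    show ?thesis using i m gL by (simp add: h.hom_nat_pow nat_pow_pow mult.commute)
  qed
  then show ?thesis using that m(1) by blast
qed


section \<open>The Galois group, fixed elements and the norm in terms of Frobenius powers\<close>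

lemma galois_eq_frob:
  assumes "\<tau> \<in> carrier (galois_group L F)"
  obtains m where "m < r" and "\<And>x. x \<in> carrier L \<Longrightarrow> \<tau> x = x [^] (q ^ m)"
  using hom_eq_frob[of \<tau>] assms by (auto simp: galois_group_def ring_iso_def)

text \<open>Injectivity gives bijectivity on a finite carrier. The case \<open>i = 1\<close>
  supplies the nontrivial automorphism used to show that a generator is not the identity.\<close>

lemma frob_in_galois: "(\<lambda>x\<in>carrier L. x [^] (q ^ i)) \<in> carrier (galois_group L F)"
proof -
  have "(\<lambda>x. x [^] (q ^ i)) ` carrier L = carrier L"
    by (rule endo_inj_surj[OF finite_L]) (auto intro: inj_onI frob_inj)
  then have bij: "bij_betw (\<lambda>x\<in>carrier L. x [^] (q ^ i)) (carrier L) (carrier L)"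
    by (auto simp: bij_betw_def inj_on_def intro: frob_inj)
  then show ?thesis
    using F_subset frob_fixes_F[of _ i]
    by (auto simp: galois_group_def Bij_def nat_pow_distrib frob_add intro!: ring_iso_memI)
qed

text \<open>If \<open>e\<close> were 0, \<sigma> would be the identity and generate a trivial group;
  but the q-Frobenius belongs to the group and is nontrivial because \<open>F\<close> is smaller
  than \<open>L\<close>.\<close>

lemma galois_generator_frob:
  fixes \<sigma> :: "'a \<Rightarrow> 'a"
  assumes "\<sigma> \<in> carrier (galois_group L F)"
    and gen: "generate (galois_group L F) {\<sigma>} = carrier (galois_group L F)"
  obtains e where "0 < e" and "e < r" and "\<And>x. x \<in> carrier L \<Longrightarrow> \<sigma> x = x [^] (q ^ e)"
proof -
  let ?G = "galois_group L F"
  obtain e where e: "e < r" "\<And>x. x \<in> carrier L \<Longrightarrow> \<sigma> x = x [^] (q ^ e)"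
    using galois_eq_frob[OF assms(1)] by blast
  have "e \<noteq> 0"
  proof
    assume "e = 0"
    have ext: "\<tau> \<in> extensional (carrier L)" "\<tau> \<in> Bij (carrier L)" if "\<tau> \<in> carrier ?G" for \<tau>
      using that by (auto simp: galois_group_def Bij_def)
    have one: "\<one>\<^bsub>?G\<^esub> = (\<lambda>x\<in>carrier L. x)"
      by (simp add: galois_group_def BijGroup_def)
    have mult: "\<tau> \<otimes>\<^bsub>?G\<^esub> \<rho> = compose (carrier L) \<tau> \<rho>"
      if "\<tau> \<in> Bij (carrier L)" "\<rho> \<in> Bij (carrier L)" for \<tau> \<rho>
      using that by (simp add: galois_group_def BijGroup_def)
    have \<sigma>: "\<sigma> = \<one>\<^bsub>?G\<^esub>"
      unfolding one
      by (rule extensionalityI[OF ext(1)[OF assms(1)]]) (use e \<open>e = 0\<close> in auto)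
    have oneG: "\<one>\<^bsub>?G\<^esub> \<in> carrier ?G" using assms(1) \<sigma> by simp
    \<comment> \<open>The group axioms have not been established for \<open>?G\<close>, so the unit
      laws and the inverse of the unit are computed directly from composition.\<close>
    have one_mult: "\<tau> \<otimes>\<^bsub>?G\<^esub> \<one>\<^bsub>?G\<^esub> = \<tau>" "\<one>\<^bsub>?G\<^esub> \<otimes>\<^bsub>?G\<^esub> \<tau> = \<tau>" if \<tau>: "\<tau> \<in> carrier ?G" for \<tau>
    proof -
      note f = Bij_imp_funcset[OF ext(2)[OF \<tau>]] ext(1)[OF \<tau>]
      show "\<tau> \<otimes>\<^bsub>?G\<^esub> \<one>\<^bsub>?G\<^esub> = \<tau>"
        unfolding mult[OF ext(2)[OF \<tau>] ext(2)[OF oneG]] unfolding one by (rule compose_Id[OF f])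
      show "\<one>\<^bsub>?G\<^esub> \<otimes>\<^bsub>?G\<^esub> \<tau> = \<tau>"
        unfolding mult[OF ext(2)[OF oneG] ext(2)[OF \<tau>]] unfolding one by (rule Id_compose[OF f])
    qed
    have inv: "inv\<^bsub>?G\<^esub> \<one>\<^bsub>?G\<^esub> = \<one>\<^bsub>?G\<^esub>"
      unfolding m_inv_def by (rule the_equality) (use one_mult oneG in auto)
    have "\<tau> = \<one>\<^bsub>?G\<^esub>" if "\<tau> \<in> generate ?G {\<sigma>}" for \<tau>
      using that by induction (auto simp: \<sigma> inv one_mult oneG)
    then have eq: "(\<lambda>x\<in>carrier L. x [^] (q ^ 1)) = (\<lambda>x\<in>carrier L. x)"
      using gen frob_in_galois[of 1] one by auto
    have "x [^] q = x" if "x \<in> carrier L" for x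
      using fun_cong[OF eq, of x] that by simp
    then have "F = carrier L" using subfield_eq_frob_fixed by auto
    then have "q ^ 1 = q ^ r" using card_F card_L by simp
    then show False using q_gt_1 r power_inject_exp[of q 1 r] by simp
  qed
  then show ?thesis using that e by blast
qed

text \<open>If \<open>u\<close> inverts \<open>d\<close> modulo \<open>r\<close>, the
  \<open>u\<close>-th iterate of the \<open>d\<close>-th Frobenius power is the q-Frobenius itself,
  so \<open>x\<close> is fixed by the latter.\<close>

lemma frob_fixed_imp_mem:
  assumes "x \<in> carrier L" and "x [^] (q ^ d) = x" and "coprime d r"
  shows "x \<in> F"
proof -
  obtain u where "[d * u = Suc 0] (mod r)" using cong_solve_coprime_nat[OF assms(3)] by blast
  then have u: "d * u mod r = 1" using r by (simp add: cong_def)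
  have "x [^] (q ^ (d * u)) = x" by (rule frob_mult_period[OF assms(1,2)])
  then have "x [^] q = x" using frob_mod[OF assms(1), of "d * u"] u by simp
  then show ?thesis using assms(1) subfield_eq_frob_fixed by blast
qed

text \<open>Multiplication by \<open>e\<close> permutes the residues modulo \<open>r\<close>, so the
  product of the conjugates is the same for every generator.\<close>

lemma norm_eq_pow:
  assumes "k \<in> carrier L" and "coprime e r"
  shows "k [^] (\<Sum>i<r. q ^ (e * i)) = k [^] (\<Sum>i<r. q ^ i)"
proof -
  have "k [^] (\<Sum>i<n. q ^ (e * i)) = k [^] (\<Sum>i<n. q ^ (e * i mod r))" for n
    using assms(1) by (induction n) (simp_all add: frob_mod flip: nat_pow_mult)
  moreover have "(\<Sum>i<r. q ^ (e * i mod r)) = (\<Sum>i<r. q ^ i)"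
  proof (rule sum.reindex_bij_betw)
    have "inj_on (\<lambda>i. e * i mod r) {..<r}"
    proof (rule inj_onI)
      fix i j assume "i \<in> {..<r}" "j \<in> {..<r}" "e * i mod r = e * j mod r"
      then show "i = j"
        using cong_mult_lcancel_nat[OF assms(2), of i j] by (simp add: cong_def)
    qed
    moreover have "(\<lambda>i. e * i mod r) ` {..<r} \<subseteq> {..<r}" using r by auto
    ultimately show "bij_betw (\<lambda>i. e * i mod r) {..<r} {..<r}"
      by (simp add: bij_betw_def endo_inj_surj)
  qed
  ultimately show ?thesis by simp
qed

end

section \<open>Multiplication in the cyclic algebra\<close>

text \<open>The generator of the Galois group is recorded as an explicit Frobenius power, which
  turns its iterates into exponents.\<close>

locale finite_cyclic_algebra = finite_field_ext +
  fixes \<sigma> :: "'a \<Rightarrow> 'a" and e :: nat and a :: 'a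
  assumes prime_r: "Factorial_Ring.prime r"
    and e: "0 < e" "e < r" and \<sigma>: "\<And>x. x \<in> carrier L \<Longrightarrow> \<sigma> x = x [^] (q ^ e)"
    and r_ndvd: "\<not> r dvd (q - 1)" and a: "a \<in> carrier L - F"
begin

abbreviation "A \<equiv> nonassoc_cyclic_algebra L F \<sigma> a"
abbreviation "M \<equiv> nca_monom L r"

text \<open>\<open>sg i\<close> is \<open>\<sigma>\<^sup>i\<close>, and \<open>(l z\<^sup>i) (m z\<^sup>j) = (l \<sigma>\<^sup>i(m) wrap i j) z\<^sup>k\<close> with \<open>k = (i + j) mod r\<close>.
  \<open>nrm k i\<close> is the coefficient of \<open>(k z)\<^sup>i\<close>; in particular \<open>nrm k r\<close> is the norm of \<open>k\<close>.\<close>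

definition sg :: "nat \<Rightarrow> 'a \<Rightarrow> 'a"
  where "sg i x = x [^] (q ^ (e * i))"

definition wrap :: "nat \<Rightarrow> nat \<Rightarrow> 'a"
  where "wrap i j = (if i + j < r then \<one> else a)"

definition nrm :: "'a \<Rightarrow> nat \<Rightarrow> 'a"
  where "nrm k i = k [^] (\<Sum>j<i. q ^ (e * j))"

lemma a_closed: "a \<in> carrier L" and a_notin: "a \<notin> F"
  using a by auto

lemma r_pos: "0 < r"
  using r by simp

lemma coprime_less: "0 < i \<Longrightarrow> i < r \<Longrightarrow> coprime i r"
  using prime_r by (metis coprime_commute nat_dvd_not_less prime_imp_coprime)

lemma coprime_e: "coprime e r"
  using coprime_less e by simp

lemma sg_closed [simp]: "x \<in> carrier L \<Longrightarrow> sg i x \<in> carrier L"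
  by (simp add: sg_def)

lemma sg_mult: "x \<in> carrier L \<Longrightarrow> y \<in> carrier L \<Longrightarrow> sg i (x \<otimes> y) = sg i x \<otimes> sg i y"
  by (simp add: sg_def nat_pow_distrib)

lemma sg_one [simp]: "sg i \<one> = \<one>"
  by (simp add: sg_def)

lemma sg_zero [simp]: "sg i \<zero> = \<zero>"
  using q_gt_1 by (simp add: sg_def nat_pow_zero)

lemma sg_0 [simp]: "x \<in> carrier L \<Longrightarrow> sg 0 x = x"
  by (simp add: sg_def)

lemma sg_sg: "x \<in> carrier L \<Longrightarrow> sg i (sg j x) = sg (i + j) x"
  by (simp add: sg_def frob_frob distrib_left add.commute)

lemma sg_frob: "x \<in> carrier L \<Longrightarrow> sg i (x [^] (q ^ m)) = (sg i x) [^] (q ^ m)"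
  by (simp add: sg_def frob_frob add.commute)

lemma sg_inj: "x \<in> carrier L \<Longrightarrow> y \<in> carrier L \<Longrightarrow> sg i x = sg i y \<Longrightarrow> x = y"
  unfolding sg_def by (rule frob_inj)

lemma \<sigma>_funpow: "x \<in> carrier L \<Longrightarrow> (\<sigma> ^^ i) x = sg i x"
  by (induction i) (simp_all add: \<sigma> sg_def frob_frob add.commute)

text \<open>As \<open>r\<close> is prime, a nontrivial power of \<sigma> fixes only
  \<open>F\<close>, and \<open>a\<close> lies outside \<open>F\<close>.\<close>

lemma sg_a_eq_a: "i < r \<Longrightarrow> sg i a = a \<Longrightarrow> i = 0"
  using frob_fixed_imp_mem[OF a_closed, of "e * i"] a_notin coprime_e coprime_less[of i]
  by (auto simp: sg_def)

text \<open>Cancelling the smaller power of \<sigma> reduces this to \<open>sg_a_eq_a\<close>.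
  Distinct conjugates of \<open>a\<close> later separate the coefficients of the image of
  \<open>z\<close>.\<close>

lemma sg_a_inj:
  assumes "i < r" "j < r" "sg i a = sg j a" shows "i = j"
proof -
  have "i = j" if "i \<le> j" "j < r" "sg i a = sg j a" for i j
  proof -
    have "sg i a = sg i (sg (j - i) a)" using that a_closed by (simp add: sg_sg)
    then have "sg (j - i) a = a" using sg_inj a_closed sg_closed by metis
    then have "j - i = 0" using that by (intro sg_a_eq_a) linarith+
    then show ?thesis using that by simp
  qed
  then show ?thesis using assms by (metis nat_le_linear)
qed

lemma wrap_closed [simp]: "wrap i j \<in> carrier L"
  using a_closed by (simp add: wrap_def)

lemma wrap_0 [simp]: "i < r \<Longrightarrow> wrap i 0 = \<one>" "i < r \<Longrightarrow> wrap 0 i = \<one>"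
  by (simp_all add: wrap_def)

section \<open>Coordinates of the algebra, its product and its left nucleus\<close>

lemma dim_L: "ring.dim L F (carrier L) = r"
  using dimI[OF F dim] by (simp add: over_def)

lemma carrier_A: "carrier A = {..<r} \<rightarrow>\<^sub>E carrier L"
  and one_A: "\<one>\<^bsub>A\<^esub> = M \<one> 0"
  and add_A: "x \<oplus>\<^bsub>A\<^esub> y = (\<lambda>k\<in>{..<r}. x k \<oplus> y k)"
  and smult_A: "c \<odot>\<^bsub>A\<^esub> x = (\<lambda>k\<in>{..<r}. c \<otimes> x k)"
  by (simp_all add: nonassoc_cyclic_algebra_def Let_def dim_L)

lemma A_coeff [simp]: "x \<in> carrier A \<Longrightarrow> i < r \<Longrightarrow> x i \<in> carrier L"
  unfolding carrier_A by auto

lemma A_eqI: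
  assumes "x \<in> carrier A" "y \<in> carrier A" "\<And>i. i < r \<Longrightarrow> x i = y i"
  shows "x = y"
  using assms unfolding carrier_A by (intro PiE_ext) auto

lemma M_apply: "i < r \<Longrightarrow> M l k i = (if i = k then l else \<zero>)"
  by (simp add: nca_monom_def)

lemma M_closed [simp]: "l \<in> carrier L \<Longrightarrow> M l k \<in> carrier A"
  unfolding carrier_A nca_monom_def by auto

text \<open>Since \<open>i + j < 2 * r\<close>, subtracting \<open>r\<close> in the second case is
  reduction modulo \<open>r\<close>, which merges both cases of the product.\<close>

lemma nca_monom_mult_apply:
  assumes "l \<in> carrier L" "m \<in> carrier L" "i < r" "j < r" "k < r"
  shows "nca_monom_mult L r \<sigma> a l i m j k
    = (if (i + j) mod r = k then l \<otimes> sg i m \<otimes> wrap i j else \<zero>)"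
  using assms
  by (auto simp: nca_monom_mult_def M_apply \<sigma>_funpow wrap_def mod_if le_mod_geq a_closed)

lemma mult_A:
  assumes "x \<in> carrier A" "y \<in> carrier A" "k < r"
  shows "(x \<otimes>\<^bsub>A\<^esub> y) k = (\<Oplus>i\<in>{..<r}. \<Oplus>j\<in>{..<r}.
    if (i + j) mod r = k then x i \<otimes> sg i (y j) \<otimes> wrap i j else \<zero>)"
proof -
  have "(x \<otimes>\<^bsub>A\<^esub> y) k
      = (\<Oplus>i\<in>{..<r}. \<Oplus>j\<in>{..<r}. nca_monom_mult L r \<sigma> a (x i) i (y j) j k)"
    using assms(3) by (simp add: nonassoc_cyclic_algebra_def Let_def dim_L)
  also have "\<dots> = (\<Oplus>i\<in>{..<r}. \<Oplus>j\<in>{..<r}.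
      if (i + j) mod r = k then x i \<otimes> sg i (y j) \<otimes> wrap i j else \<zero>)"
    using assms by (intro finsum_cong' funcsetI finsum_closed) (auto simp: nca_monom_mult_apply)
  finally show ?thesis .
qed

lemma mult_closed_A:
  assumes "x \<in> carrier A" "y \<in> carrier A" shows "x \<otimes>\<^bsub>A\<^esub> y \<in> carrier A"
proof -
  have "(x \<otimes>\<^bsub>A\<^esub> y) k \<in> carrier L" if "k < r" for k
    unfolding mult_A[OF assms that] using assms by (intro finsum_closed funcsetI) auto
  moreover have "x \<otimes>\<^bsub>A\<^esub> y \<in> extensional {..<r}"
    by (simp add: nonassoc_cyclic_algebra_def Let_def dim_L)
  ultimately show ?thesis unfolding carrier_A by (auto simp: PiE_def)
qed

lemma add_closed_A:
  assumes "x \<in> carrier A" "y \<in> carrier A" shows "x \<oplus>\<^bsub>A\<^esub> y \<in> carrier A"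
  using assms unfolding add_A carrier_A by auto

lemma add_mod_cancel:
  "(i + j) mod r = (i' + j) mod r \<Longrightarrow> i < r \<Longrightarrow> i' < r \<Longrightarrow> i = (i'::nat)"
  using cong_add_rcancel_nat[of i j i' r] by (simp add: cong_def)

text \<open>Given \<open>j\<close> and the target \<open>k\<close>, only one index \<open>i\<close>
  satisfies \<open>(i + j) mod r = k\<close>, so the double sum collapses to one term.\<close>

lemma mult_M:
  assumes "x \<in> carrier A" "m \<in> carrier L" "i < r" "j < r" "(i + j) mod r = k"
  shows "(x \<otimes>\<^bsub>A\<^esub> M m j) k = x i \<otimes> sg i m \<otimes> wrap i j"
proof -
  have k: "k < r" using assms(5) r_pos by auto
  have inner: "(\<Oplus>j'\<in>{..<r}. if (i' + j') mod r = k then x i' \<otimes> sg i' (M m j j') \<otimes> wrap i' j' else \<zero>)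
    = (if i = i' then x i' \<otimes> sg i' m \<otimes> wrap i' j else \<zero>)" if i': "i' < r" for i'
  proof -
    have iff: "(i' + j) mod r = k \<longleftrightarrow> i = i'"
      by (metis add_mod_cancel assms(3,5) i')
    have "(\<Oplus>j'\<in>{..<r}. if (i' + j') mod r = k then x i' \<otimes> sg i' (M m j j') \<otimes> wrap i' j' else \<zero>)
      = (\<Oplus>j'\<in>{..<r}. if j = j' then (if i = i' then x i' \<otimes> sg i' m \<otimes> wrap i' j' else \<zero>) else \<zero>)"
      using assms(1-4) i' iff by (intro finsum_cong' funcsetI) (auto simp: M_apply)
    also have "\<dots> = (if i = i' then x i' \<otimes> sg i' m \<otimes> wrap i' j else \<zero>)"
      using assms(1-4) i' by (subst finsum_singleton) auto
    finally show ?thesis .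
  qed
  have "(x \<otimes>\<^bsub>A\<^esub> M m j) k
      = (\<Oplus>i'\<in>{..<r}. if i = i' then x i' \<otimes> sg i' m \<otimes> wrap i' j else \<zero>)"
    unfolding mult_A[OF assms(1) M_closed[OF assms(2)] k]
    using assms(1-4) inner by (intro finsum_cong' funcsetI) auto
  also have "\<dots> = x i \<otimes> sg i m \<otimes> wrap i j"
    using assms(1-4) by (subst finsum_singleton) auto
  finally show ?thesis .
qed

lemma M_mult:
  assumes "y \<in> carrier A" "l \<in> carrier L" "i < r" "j < r" "(i + j) mod r = k"
  shows "(M l i \<otimes>\<^bsub>A\<^esub> y) k = l \<otimes> sg i (y j) \<otimes> wrap i j"
proof -
  have k: "k < r" using assms(5) r_pos by auto
  have iff: "(i + j') mod r = k \<longleftrightarrow> j = j'" if "j' < r" for j'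
    by (metis add.commute add_mod_cancel assms(4,5) that)
  have inner: "(\<Oplus>j'\<in>{..<r}. if (i' + j') mod r = k then M l i i' \<otimes> sg i' (y j') \<otimes> wrap i' j' else \<zero>)
    = (if i = i' then l \<otimes> sg i (y j) \<otimes> wrap i j else \<zero>)" if i': "i' < r" for i'
  proof -
    have "(\<Oplus>j'\<in>{..<r}. if (i' + j') mod r = k then M l i i' \<otimes> sg i' (y j') \<otimes> wrap i' j' else \<zero>)
      = (\<Oplus>j'\<in>{..<r}. if j = j' then (if i = i' then l \<otimes> sg i (y j') \<otimes> wrap i j' else \<zero>) else \<zero>)"
      using assms(1-4) i' iff by (intro finsum_cong' funcsetI) (auto simp: M_apply)
    also have "\<dots> = (if i = i' then l \<otimes> sg i (y j) \<otimes> wrap i j else \<zero>)"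
      using assms(1-4) i' by (subst finsum_singleton) auto
    finally show ?thesis .
  qed
  have "(M l i \<otimes>\<^bsub>A\<^esub> y) k
      = (\<Oplus>i'\<in>{..<r}. if i = i' then l \<otimes> sg i (y j) \<otimes> wrap i j else \<zero>)"
    unfolding mult_A[OF M_closed[OF assms(2)] assms(1) k]
    using assms(1-4) inner by (intro finsum_cong' funcsetI) auto
  also have "\<dots> = l \<otimes> sg i (y j) \<otimes> wrap i j"
    using assms(1-4) by (subst finsum_singleton) auto
  finally show ?thesis .
qed

lemma M_mult_M:
  assumes "l \<in> carrier L" "m \<in> carrier L" "i < r" "j < r"
  shows "M l i \<otimes>\<^bsub>A\<^esub> M m j = M (l \<otimes> sg i m \<otimes> wrap i j) ((i + j) mod r)"
proof (rule A_eqI)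
  fix k assume k: "k < r"
  \<comment> \<open>\<open>j'\<close> is the only position of the right factor that contributes to
    coefficient \<open>k\<close>.\<close>
  define j' where "j' = (k + (r - i)) mod r"
  have j': "j' < r" "(i + j') mod r = k"
    using assms k by (simp_all add: j'_def mod_add_right_eq)
  show "(M l i \<otimes>\<^bsub>A\<^esub> M m j) k = M (l \<otimes> sg i m \<otimes> wrap i j) ((i + j) mod r) k"
  proof -
    have "j' = j \<longleftrightarrow> k = (i + j) mod r"
      by (metis add.commute add_mod_cancel assms(4) j')
    then show ?thesis
      using M_mult[OF M_closed[OF assms(2)] assms(1,3) j'] assms(1,2) j'(1) k
      by (cases "j' = j") (simp_all add: M_apply)
  qed
qed (use assms in \<open>auto intro: mult_closed_A\<close>)

lemma M0_mult_apply: "y \<in> carrier A \<Longrightarrow> l \<in> carrier L \<Longrightarrow> k < r \<Longrightarrow> (M l 0 \<otimes>\<^bsub>A\<^esub> y) k = l \<otimes> y k"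
  using M_mult[of y l 0 k k] r_pos by simp

text \<open>A scalar on the far left is untouched by \<sigma> and factors out of both sums; hence
  \<open>L\<close> lies in the left nucleus.\<close>

lemma M0_mult_assoc:
  assumes "l \<in> carrier L" "x \<in> carrier A" "y \<in> carrier A"
  shows "(M l 0 \<otimes>\<^bsub>A\<^esub> x) \<otimes>\<^bsub>A\<^esub> y = M l 0 \<otimes>\<^bsub>A\<^esub> (x \<otimes>\<^bsub>A\<^esub> y)"
proof (rule A_eqI)
  fix k assume k: "k < r"
  let ?c = "\<lambda>i j. if (i + j) mod r = k then x i \<otimes> sg i (y j) \<otimes> wrap i j else \<zero>"
  have c: "?c i j \<in> carrier L" if "i < r" "j < r" for i j using assms that by auto
  have "((M l 0 \<otimes>\<^bsub>A\<^esub> x) \<otimes>\<^bsub>A\<^esub> y) k = (\<Oplus>i\<in>{..<r}. \<Oplus>j\<in>{..<r}. l \<otimes> ?c i j)"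
    unfolding mult_A[OF mult_closed_A[OF M_closed[OF assms(1)] assms(2)] assms(3) k]
    using assms c by (intro finsum_cong' funcsetI finsum_closed) (auto simp: M0_mult_apply m_assoc)
  also have "\<dots> = (\<Oplus>i\<in>{..<r}. l \<otimes> (\<Oplus>j\<in>{..<r}. ?c i j))"
    using assms c by (intro finsum_cong' funcsetI m_closed finsum_closed finsum_rdistr[symmetric]) auto
  also have "\<dots> = l \<otimes> (\<Oplus>i\<in>{..<r}. \<Oplus>j\<in>{..<r}. ?c i j)"
    using assms c by (intro finsum_rdistr[symmetric] funcsetI finsum_closed) auto
  also have "\<dots> = (M l 0 \<otimes>\<^bsub>A\<^esub> (x \<otimes>\<^bsub>A\<^esub> y)) k"
    using M0_mult_apply[OF mult_closed_A[OF assms(2,3)] assms(1) k] mult_A[OF assms(2,3) k] by simp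
  finally show "((M l 0 \<otimes>\<^bsub>A\<^esub> x) \<otimes>\<^bsub>A\<^esub> y) k = (M l 0 \<otimes>\<^bsub>A\<^esub> (x \<otimes>\<^bsub>A\<^esub> y)) k" .
qed (simp_all add: mult_closed_A assms)

text \<open>One associator suffices: at coefficient \<open>k\<close> the two sides are
  \<open>u k \<otimes> a\<close> and \<open>u k \<otimes> sg k a\<close>, which for
  \<open>k \<noteq> 0\<close> forces \<open>u k = \<zero>\<close>.\<close>

lemma left_nucleus:
  assumes u: "u \<in> carrier A"
    and assoc: "(u \<otimes>\<^bsub>A\<^esub> M \<one> 1) \<otimes>\<^bsub>A\<^esub> M \<one> (r - 1) = u \<otimes>\<^bsub>A\<^esub> (M \<one> 1 \<otimes>\<^bsub>A\<^esub> M \<one> (r - 1))"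
  shows "u = M (u 0) 0"
proof (rule A_eqI[OF u])
  fix k assume k: "k < r"
  \<comment> \<open>Right multiplication by \<open>z\<close> moves coefficient \<open>k\<close> to
    position \<open>i\<close>, and \<open>M \<one> (r - 1)\<close> moves it back.\<close>
  define i where "i = (k + 1) mod r"
  have i: "i < r" "(k + 1) mod r = i"
    using r_pos by (simp_all add: i_def)
  have i_wrap: "(i + (r - 1)) mod r = k"
  proof -
    have "(i + (r - 1)) mod r = (k + 1 + (r - 1)) mod r" unfolding i_def by (rule mod_add_left_eq)
    also have "k + 1 + (r - 1) = k + r" using r_pos by simp
    finally show ?thesis using k by simp
  qed
  have uk: "u k \<in> carrier L" using u k by simp
  have "M \<one> 1 \<otimes>\<^bsub>A\<^esub> M \<one> (r - 1) = M a 0"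
    using M_mult_M[of \<one> \<one> 1 "r - 1"] r a_closed by (simp add: wrap_def)
  then have "u k \<otimes> sg k a = ((u \<otimes>\<^bsub>A\<^esub> M \<one> 1) \<otimes>\<^bsub>A\<^esub> M \<one> (r - 1)) k"
    using mult_M[OF u a_closed k r_pos] assoc k uk a_closed by simp
  also have "\<dots> = (u \<otimes>\<^bsub>A\<^esub> M \<one> 1) i \<otimes> wrap i (r - 1)"
    using mult_M[OF mult_closed_A[OF u M_closed[OF one_closed]] one_closed i(1) _ i_wrap] r u i
    by (simp add: mult_closed_A)
  also have "\<dots> = u k \<otimes> wrap k 1 \<otimes> wrap i (r - 1)"
    using mult_M[OF u one_closed k _ i(2)] r uk by simp
  \<comment> \<open>Exactly one of the two shifts wraps around: the first if
    \<open>k = r - 1\<close>, the second otherwise.\<close>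
  also have "\<dots> = u k \<otimes> a"
  proof (cases "k + 1 < r")
    case True
    then show ?thesis using uk a_closed by (simp add: wrap_def i_def)
  next
    case False
    then have "k = r - 1" using k by simp
    then show ?thesis using uk a_closed r by (simp add: wrap_def i_def)
  qed
  finally have eq: "u k \<otimes> sg k a = u k \<otimes> a" .
  show "u k = M (u 0) 0 k"
  proof (cases "k = 0")
    case False
    then have "sg k a \<noteq> a" using sg_a_eq_a k by blast
    then have "u k = \<zero>" using m_lcancel[of "u k" "sg k a" a] eq uk a_closed by auto
    then show ?thesis using False k by (simp add: M_apply)
  qed (use k in \<open>simp add: M_apply\<close>)
qed (use u r_pos in simp)


section \<open>Partial norms and the automorphisms they define\<close>

lemma nrm_closed [simp]: "k \<in> carrier L \<Longrightarrow> nrm k i \<in> carrier L"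
  by (simp add: nrm_def)

lemma nrm_0 [simp]: "nrm k 0 = \<one>"
  by (simp add: nrm_def)

lemma nrm_add: "k \<in> carrier L \<Longrightarrow> nrm k (i + j) = nrm k i \<otimes> sg i (nrm k j)"
proof -
  assume k: "k \<in> carrier L"
  have "(\<Sum>j'<i + j. q ^ (e * j')) = (\<Sum>j'<i. q ^ (e * j')) + (\<Sum>j'<j. q ^ (e * j')) * q ^ (e * i)"
    by (induction j) (simp_all add: algebra_simps power_add)
  then show ?thesis using k by (simp add: nrm_def sg_def nat_pow_mult nat_pow_pow)
qed

lemma nrm_1: "k \<in> carrier L \<Longrightarrow> nrm k (Suc 0) = k"
  by (simp add: nrm_def)

lemma nrm_Suc: "k \<in> carrier L \<Longrightarrow> nrm k (Suc i) = k \<otimes> sg 1 (nrm k i)"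
  using nrm_add[of k 1 i] nrm_1 by simp

lemma nrm_r: "k \<in> carrier L \<Longrightarrow> nrm k r = k [^] (\<Sum>i<r. q ^ i)"
  unfolding nrm_def by (rule norm_eq_pow[OF _ coprime_e])

lemma nrm_mult: "k \<in> carrier L \<Longrightarrow> l \<in> carrier L \<Longrightarrow> nrm (k \<otimes> l) i = nrm k i \<otimes> nrm l i"
  by (simp add: nrm_def nat_pow_distrib)

text \<open>Reducing \<open>i + j\<close> modulo \<open>r\<close> drops the factor
  \<open>sg (i + j - r) (nrm k r)\<close>, which is 1. This is how the norm condition makes
  \<open>twist k\<close> multiplicative.\<close>

lemma nrm_wrap:
  assumes k: "k \<in> carrier L" "nrm k r = \<one>" and "i < r" "j < r"
  shows "nrm k i \<otimes> sg i (nrm k j) = nrm k ((i + j) mod r)"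
proof (cases "i + j < r")
  case True
  then show ?thesis using nrm_add[OF k(1), of i j] by simp
next
  case False
  then have "(i + j) mod r = i + j - r" using assms by (simp add: le_mod_geq)
  moreover have "nrm k (i + j) = nrm k (i + j - r)"
    using nrm_add[OF k(1), of "i + j - r" r] False k by simp
  ultimately show ?thesis using nrm_add[OF k(1), of i j] by simp
qed

text \<open>The \<open>L\<close>-linear map sending \<open>z\<^sup>i\<close> to \<open>(k z)\<^sup>i\<close>.\<close>

definition twist :: "'a \<Rightarrow> (nat \<Rightarrow> 'a) \<Rightarrow> (nat \<Rightarrow> 'a)" where
  "twist k = (\<lambda>x\<in>carrier A. \<lambda>i\<in>{..<r}. x i \<otimes> nrm k i)"

lemma twist_apply: "x \<in> carrier A \<Longrightarrow> i < r \<Longrightarrow> twist k x i = x i \<otimes> nrm k i"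
  by (simp add: twist_def)

lemma twist_closed: "k \<in> carrier L \<Longrightarrow> x \<in> carrier A \<Longrightarrow> twist k x \<in> carrier A"
  by (auto simp: twist_def carrier_A)

lemma twist_twist:
  assumes "k \<in> carrier L" "l \<in> carrier L" "x \<in> carrier A"
  shows "twist k (twist l x) = twist (k \<otimes> l) x"
  by (rule A_eqI) (use assms in \<open>simp_all add: twist_apply twist_closed nrm_mult m_ac\<close>)

lemma twist_one: "x \<in> carrier A \<Longrightarrow> twist \<one> x = x"
  by (rule A_eqI) (simp_all add: twist_apply twist_closed, simp add: nrm_def)

text \<open>Each term contributing to position \<open>n\<close> gains the factor
  \<open>nrm k i \<otimes> sg i (nrm k j) = nrm k n\<close>, which depends only on \<open>n\<close>
  and factors out.\<close>

lemma twist_mult: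
  assumes k: "k \<in> carrier L" "nrm k r = \<one>" and x: "x \<in> carrier A" and y: "y \<in> carrier A"
  shows "twist k (x \<otimes>\<^bsub>A\<^esub> y) = twist k x \<otimes>\<^bsub>A\<^esub> twist k y"
proof (rule A_eqI)
  fix n assume n: "n < r"
  let ?c = "\<lambda>i j. if (i + j) mod r = n then x i \<otimes> sg i (y j) \<otimes> wrap i j else \<zero>"
  have c: "?c i j \<in> carrier L" if "i < r" "j < r" for i j using x y that by auto
  have eq: "(if (i + j) mod r = n then twist k x i \<otimes> sg i (twist k y j) \<otimes> wrap i j else \<zero>)
      = ?c i j \<otimes> nrm k n" if ij: "i < r" "j < r" for i j
  proof (cases "(i + j) mod r = n")
    case True
    have "twist k x i \<otimes> sg i (twist k y j) \<otimes> wrap i j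
        = x i \<otimes> sg i (y j) \<otimes> wrap i j \<otimes> (nrm k i \<otimes> sg i (nrm k j))"
      using x y ij k by (simp add: twist_apply sg_mult m_ac)
    then show ?thesis using True nrm_wrap[OF k ij] by simp
  qed (use k in simp)
  have "(twist k x \<otimes>\<^bsub>A\<^esub> twist k y) n
      = (\<Oplus>i\<in>{..<r}. \<Oplus>j\<in>{..<r}. ?c i j \<otimes> nrm k n)"
    unfolding mult_A[OF twist_closed[OF k(1) x] twist_closed[OF k(1) y] n]
    using c k by (intro finsum_cong' funcsetI finsum_closed) (simp_all add: eq)
  also have "\<dots> = (\<Oplus>i\<in>{..<r}. (\<Oplus>j\<in>{..<r}. ?c i j) \<otimes> nrm k n)"
    using c k by (intro finsum_cong' funcsetI m_closed finsum_closed finsum_ldistr[symmetric]) auto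
  also have "\<dots> = (\<Oplus>i\<in>{..<r}. \<Oplus>j\<in>{..<r}. ?c i j) \<otimes> nrm k n"
    using c k by (intro finsum_ldistr[symmetric] funcsetI finsum_closed) auto
  also have "\<dots> = twist k (x \<otimes>\<^bsub>A\<^esub> y) n"
    unfolding twist_apply[OF mult_closed_A[OF x y] n] mult_A[OF x y n] ..
  finally show "twist k (x \<otimes>\<^bsub>A\<^esub> y) n = (twist k x \<otimes>\<^bsub>A\<^esub> twist k y) n" ..
qed (use assms in \<open>simp_all add: twist_closed mult_closed_A\<close>)

lemma twist_in_aut:
  assumes k: "k \<in> carrier L" "nrm k r = \<one>"
  shows "twist k \<in> carrier (alg_aut_group F A)"
proof -
  \<comment> \<open>Since \<open>nrm k r\<close> is the power of \<open>k\<close> to the geometric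
    sum, \<open>l\<close> is the inverse of \<open>k\<close>, and \<open>twist l\<close> inverts
    \<open>twist k\<close>.\<close>
  define l where "l = k [^] ((\<Sum>i<r. q ^ i) - 1)"
  have l: "l \<in> carrier L" using k by (simp add: l_def)
  have "(\<Sum>i<r. q ^ i) > 0"
    using r_pos q_gt_1 by (intro sum_pos) auto
  then have "(\<Sum>i<r. q ^ i) = Suc ((\<Sum>i<r. q ^ i) - 1)" by simp
  then have "k \<otimes> l = \<one>"
    using k nrm_r[OF k(1)] nat_pow_Suc2[OF k(1)] unfolding l_def by metis
  then have kl: "k \<otimes> l = \<one>" "l \<otimes> k = \<one>" using k(1) l by (simp_all add: m_comm)
  have bij: "bij_betw (twist k) (carrier A) (carrier A)"
    by (rule bij_betw_byWitness[where f' = "twist l"])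
      (use k l kl in \<open>auto simp: twist_twist twist_one twist_closed\<close>)
  have add: "twist k (x \<oplus>\<^bsub>A\<^esub> y) = twist k x \<oplus>\<^bsub>A\<^esub> twist k y" if "x \<in> carrier A" "y \<in> carrier A" for x y
    by (rule A_eqI)
      (use that k in \<open>simp_all add: twist_closed add_closed_A twist_apply\<close>,
       use that k in \<open>simp add: add_A twist_apply l_distr\<close>)
  have one: "twist k \<one>\<^bsub>A\<^esub> = \<one>\<^bsub>A\<^esub>"
    unfolding one_A by (rule A_eqI) (use k in \<open>auto simp: twist_closed twist_apply M_apply\<close>)
  have smult: "twist k (c \<odot>\<^bsub>A\<^esub> x) = c \<odot>\<^bsub>A\<^esub> twist k x" if "c \<in> F" "x \<in> carrier A" for c x
  proof -
    have c: "c \<in> carrier L" using that F_subset by auto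
    have cl: "c \<odot>\<^bsub>A\<^esub> y \<in> carrier A" if "y \<in> carrier A" for y
      using that c by (auto simp: smult_A carrier_A)
    show ?thesis
    proof (rule A_eqI)
      fix i assume "i < r"
      then show "twist k (c \<odot>\<^bsub>A\<^esub> x) i = (c \<odot>\<^bsub>A\<^esub> twist k x) i"
        unfolding twist_apply[OF cl[OF that(2)] \<open>i < r\<close>]
        using c k that by (simp add: smult_A twist_apply m_assoc)
    qed (use that k cl twist_closed in auto)
  qed
  have "twist k \<in> ring_iso A A"
    using k twist_closed twist_mult add one bij by (intro ring_iso_memI) auto
  moreover have "twist k \<in> Bij (carrier A)"
    using bij by (simp add: Bij_def twist_def)
  ultimately show ?thesis using smult by (simp add: alg_aut_group_def)
qed

lemma twist_compose:
  assumes "k \<in> carrier L" "nrm k r = \<one>" "l \<in> carrier L" "nrm l r = \<one>"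
  shows "twist k \<otimes>\<^bsub>alg_aut_group F A\<^esub> twist l = twist (k \<otimes> l)"
proof -
  have "twist k \<in> Bij (carrier A)" "twist l \<in> Bij (carrier A)"
    using twist_in_aut assms by (auto simp: alg_aut_group_def)
  then have "twist k \<otimes>\<^bsub>alg_aut_group F A\<^esub> twist l = compose (carrier A) (twist k) (twist l)"
    by (simp add: alg_aut_group_def BijGroup_def)
  also have "\<dots> = twist (k \<otimes> l)"
    by (rule extensionalityI[of _ "carrier A"])
      (use assms in \<open>auto simp: compose_def twist_twist, simp add: twist_def\<close>)
  finally show ?thesis .
qed

lemma twist_inj:
  assumes "k \<in> carrier L" "l \<in> carrier L" "twist k = twist l"
  shows "k = l"
proof -
  have "twist k (M \<one> 1) 1 = twist l (M \<one> 1) 1" using assms(3) by simp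
  then show ?thesis using assms(1,2) r by (simp add: twist_apply M_apply nrm_1)
qed

section \<open>Automorphisms of the cyclic algebra\<close>

context
  fixes H :: "(nat \<Rightarrow> 'a) \<Rightarrow> (nat \<Rightarrow> 'a)"
  assumes H: "H \<in> carrier (alg_aut_group F A)"
begin

lemma H_iso: "H \<in> ring_iso A A"
  using H by (simp add: alg_aut_group_def)

lemmas H_closed = ring_iso_memE(1)[OF H_iso]
  and H_mult = ring_iso_memE(2)[OF H_iso]
  and H_add = ring_iso_memE(3)[OF H_iso]
  and H_one = ring_iso_memE(4)[OF H_iso]

lemma H_preimage:
  assumes "y \<in> carrier A" obtains x where "x \<in> carrier A" "H x = y"
  using ring_iso_memE(5)[OF H_iso] assms by (metis bij_betw_imp_surj_on imageE)

text \<open>\<open>H\<close> need not fix the two test elements of \<open>left_nucleus\<close>, so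
  their preimages are inserted into \<open>M0_mult_assoc\<close> and the identity is
  transported.\<close>

lemma H_scalar:
  assumes l: "l \<in> carrier L" shows "H (M l 0) = M (H (M l 0) 0) 0"
proof (rule left_nucleus)
  obtain x y where x: "x \<in> carrier A" "H x = M \<one> 1" and y: "y \<in> carrier A" "H y = M \<one> (r - 1)"
    using H_preimage M_closed one_closed by metis
  have "H ((M l 0 \<otimes>\<^bsub>A\<^esub> x) \<otimes>\<^bsub>A\<^esub> y) = H (M l 0 \<otimes>\<^bsub>A\<^esub> (x \<otimes>\<^bsub>A\<^esub> y))"
    using M0_mult_assoc[OF l x(1) y(1)] by simp
  then show "(H (M l 0) \<otimes>\<^bsub>A\<^esub> M \<one> 1) \<otimes>\<^bsub>A\<^esub> M \<one> (r - 1)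
      = H (M l 0) \<otimes>\<^bsub>A\<^esub> (M \<one> 1 \<otimes>\<^bsub>A\<^esub> M \<one> (r - 1))"
    using l x y by (simp add: H_mult mult_closed_A)
qed (use l H_closed in simp)

lemma H_scalar_frob:
  obtains m where "m < r" and "\<And>l. l \<in> carrier L \<Longrightarrow> H (M l 0) = M (l [^] (q ^ m)) 0"
proof -
  define \<tau> where "\<tau> l = H (M l 0) 0" for l
  have \<tau>: "H (M l 0) = M (\<tau> l) 0" "\<tau> l \<in> carrier L" if "l \<in> carrier L" for l
    using H_scalar[OF that] H_closed that r_pos by (auto simp: \<tau>_def)
  have "\<tau> \<in> ring_hom L L"
  proof (rule ring_hom_memI)
    fix x y assume xy: "x \<in> carrier L" "y \<in> carrier L"
    have "M (x \<otimes> y) 0 = M x 0 \<otimes>\<^bsub>A\<^esub> M y 0"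
      using M_mult_M[OF xy r_pos r_pos] xy r_pos by simp
    then have "H (M (x \<otimes> y) 0) = M (\<tau> x) 0 \<otimes>\<^bsub>A\<^esub> M (\<tau> y) 0"
      using xy by (simp only: H_mult M_closed \<tau>(1))
    then show "\<tau> (x \<otimes> y) = \<tau> x \<otimes> \<tau> y"
      using M0_mult_apply[OF M_closed[OF \<tau>(2)[OF xy(2)]] \<tau>(2)[OF xy(1)] r_pos] r_pos
      by (simp add: \<tau>_def M_apply)
    have "M (x \<oplus> y) 0 = M x 0 \<oplus>\<^bsub>A\<^esub> M y 0"
      by (rule A_eqI) (use xy in \<open>auto simp: add_closed_A, auto simp: add_A M_apply\<close>)
    then show "\<tau> (x \<oplus> y) = \<tau> x \<oplus> \<tau> y"
      using xy r_pos by (simp add: \<tau>_def H_add) (simp add: add_A)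
  next
    show "\<tau> \<one> = \<one>"
      using H_one r_pos by (simp add: \<tau>_def one_A M_apply)
  qed (use \<tau> in auto)
  moreover have "\<tau> c = c" if c: "c \<in> F" for c
  proof -
    have cL: "c \<in> carrier L" using c F_subset by auto
    \<comment> \<open>\<open>F\<close> sits in the algebra as multiples of its unit, so linearity
      and \<open>H_one\<close> fix it.\<close>
    have M_c: "M c 0 = c \<odot>\<^bsub>A\<^esub> M \<one> 0"
      using cL by (auto simp: smult_A nca_monom_def)
    have "H (c \<odot>\<^bsub>A\<^esub> M \<one> 0) = c \<odot>\<^bsub>A\<^esub> H (M \<one> 0)"
      using H c by (simp add: alg_aut_group_def)
    then have "H (M c 0) = M c 0"
      using H_one by (simp add: M_c one_A)
    then show ?thesis using r_pos by (simp add: \<tau>_def M_apply)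
  qed
  ultimately obtain m where "m < r" "\<And>l. l \<in> carrier L \<Longrightarrow> \<tau> l = l [^] (q ^ m)"
    using hom_eq_frob[of \<tau>] by blast
  then show ?thesis using that[of m] \<tau>(1) by simp
qed

lemma aut_eq_twist: "\<exists>k\<in>carrier L. nrm k r = \<one> \<and> H = twist k"
proof -
  obtain m where m: "m < r" and Hm: "\<And>l. l \<in> carrier L \<Longrightarrow> H (M l 0) = M (l [^] (q ^ m)) 0"
    using H_scalar_frob by blast
  define u where "u = H (M \<one> 1)"
  define k where "k = u 1"
  have u: "u \<in> carrier A" by (simp add: u_def H_closed)
  have k: "k \<in> carrier L" using u r by (simp add: k_def)
  let ?b = "a [^] (q ^ m)"
  have b: "?b \<in> carrier L" using a_closed by simp
  \<comment> \<open>The relation \<open>z l = \<sigma>(l) z\<close> is used only for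
    \<open>l = a\<close>, whose conjugates are distinct.\<close>
  have "M \<one> 1 \<otimes>\<^bsub>A\<^esub> M a 0 = M (sg 1 a) 0 \<otimes>\<^bsub>A\<^esub> M \<one> 1"
    using M_mult_M[of \<one> a 1 0] M_mult_M[of "sg 1 a" \<one> 0 1] a_closed r by simp
  then have "H (M \<one> 1 \<otimes>\<^bsub>A\<^esub> M a 0) = H (M (sg 1 a) 0 \<otimes>\<^bsub>A\<^esub> M \<one> 1)" by simp
  then have comm: "u \<otimes>\<^bsub>A\<^esub> M ?b 0 = M (sg 1 ?b) 0 \<otimes>\<^bsub>A\<^esub> u"
    using a_closed by (simp add: H_mult Hm sg_frob u_def)
  have u_eq: "u = M k 1"
  proof (rule A_eqI[OF u])
    fix i assume i: "i < r"
    have ui: "u i \<in> carrier L" using u i by simp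
    show "u i = M k 1 i"
    proof (cases "u i = \<zero> \<or> i = 1")
      case True
      then show ?thesis using i r by (auto simp: M_apply k_def)
    next
      case False
      have "u i \<otimes> sg i ?b = sg 1 ?b \<otimes> u i"
        using arg_cong[OF comm, of "\<lambda>x. x i"] mult_M[OF u b i r_pos, of i]
          M0_mult_apply[OF u _ i, of "sg 1 ?b"] b i ui by simp
      then have "sg i ?b = sg 1 ?b"
        using False ui b m_lcancel[of "u i" "sg i ?b" "sg 1 ?b"] by (simp add: m_comm)
      \<comment> \<open>The restriction of \<open>H\<close> is a Frobenius power, so it commutes
        with \<sigma> and can be cancelled.\<close>
      then have "(sg i a) [^] (q ^ m) = (sg 1 a) [^] (q ^ m)"
        using a_closed by (simp add: sg_frob)
      then have "sg i a = sg 1 a" using frob_inj a_closed sg_closed by metis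
      then show ?thesis using sg_a_inj[of i 1] i r False by simp
    qed
  qed (use k in simp)
  have Hz: "H (M \<one> 1) = M k 1" using u_eq by (simp add: u_def)
  \<comment> \<open>Without associativity the bracketing matters: powers are built as
    \<open>z\<close> times the previous power, matching \<open>nrm_Suc\<close>.\<close>
  have H_pow: "H (M \<one> i) = M (nrm k i) i" if "i < r" for i
    using that
  proof (induction i)
    case 0
    then show ?case using Hm[OF one_closed] by simp
  next
    case (Suc i)
    have "M \<one> (Suc i) = M \<one> 1 \<otimes>\<^bsub>A\<^esub> M \<one> i"
      using M_mult_M[of \<one> \<one> 1 i] Suc.prems r by (simp add: wrap_def)
    then have "H (M \<one> (Suc i)) = M k 1 \<otimes>\<^bsub>A\<^esub> M (nrm k i) i"
      using Suc Hz by (simp add: H_mult)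
    also have "\<dots> = M (nrm k (Suc i)) (Suc i)"
      using M_mult_M[of k "nrm k i" 1 i] Suc.prems k r by (simp add: wrap_def nrm_Suc)
    finally show ?case .
  qed
  have "M a 0 = M \<one> 1 \<otimes>\<^bsub>A\<^esub> M \<one> (r - 1)"
    using M_mult_M[of \<one> \<one> 1 "r - 1"] r a_closed by (simp add: wrap_def)
  then have "M ?b 0 = M k 1 \<otimes>\<^bsub>A\<^esub> M (nrm k (r - 1)) (r - 1)"
    using H_pow[of "r - 1"] Hz Hm[OF a_closed] r by (simp add: H_mult)
  also have "\<dots> = M (nrm k r \<otimes> a) 0"
    using M_mult_M[of k "nrm k (r - 1)" 1 "r - 1"] k r nrm_Suc[OF k, of "r - 1"]
    by (simp add: wrap_def)
  finally have "M ?b 0 0 = M (nrm k r \<otimes> a) 0 0" by simp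
  then have ba: "?b = nrm k r \<otimes> a" using r_pos by (simp add: M_apply)
  define w where "w = nrm k r"
  have w: "w \<in> carrier L" using k by (simp add: w_def)
  have "a \<noteq> \<zero>" using a_notin subringE(2)[OF subfieldE(1)[OF F]] by auto
  have "k \<noteq> \<zero>"
  proof
    assume "k = \<zero>"
    then have "nrm k r = \<zero>" using nrm_Suc[OF k, of "r - 1"] k r by simp
    then have "?b = \<zero> [^] (q ^ m)" using ba a_closed q_gt_1 by (simp add: nat_pow_zero)
    then show False using frob_inj a_closed \<open>a \<noteq> \<zero>\<close> by blast
  qed
  \<comment> \<open>The norm lies in \<open>F\<close>: with \<open>s\<close> the geometric sum,
    \<open>w = k [^] s\<close> and \<open>s * (q - 1) = q ^ r - 1\<close>.\<close>
  have "w [^] (q - 1) = k [^] (q ^ r - 1)"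
    using k nrm_r[OF k] geometric_sum_nat[of q r]
    by (simp add: w_def nat_pow_pow mult.commute)
  then have w_q1: "w [^] (q - 1) = \<one>" using pow_card_minus[of k] k \<open>k \<noteq> \<zero>\<close> by simp
  have "w [^] q = w [^] Suc (q - 1)" using q_gt_1 by simp
  then have "w [^] q = w" using w w_q1 by simp
  then have w_fix: "w [^] (q ^ i) = w" for i
    using frob_mult_period[of w 1 i] w by simp
  \<comment> \<open>Iterating \<open>?b = w \<otimes> a\<close>; each round contributes one factor
    \<open>w\<close>, because Frobenius powers fix \<open>w\<close>.\<close>
  have "a [^] (q ^ (m * j)) = w [^] j \<otimes> a" for j
  proof (induction j)
    case (Suc j)
    have "a [^] (q ^ (m * Suc j)) = (a [^] (q ^ (m * j))) [^] (q ^ m)"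
      using a_closed by (simp add: frob_frob add.commute)
    also have "\<dots> = (w [^] (q ^ m)) [^] j \<otimes> ?b"
      unfolding Suc using w a_closed by (simp add: nat_pow_distrib nat_pow_pow mult.commute)
    also have "\<dots> = w [^] Suc j \<otimes> a"
      unfolding w_fix ba using w a_closed by (simp add: m_assoc flip: w_def)
    finally show ?case .
  qed (use a_closed in simp)
  \<comment> \<open>After \<open>r\<close> rounds the left side is \<open>a\<close> again.\<close>
  from this[of r] have "w [^] r \<otimes> a = \<one> \<otimes> a"
    using frob_mult_period[of a r m] a_closed by (simp add: mult.commute)
  then have w_r: "w [^] r = \<one>"
    using m_rcancel[of a "w [^] r" \<one>] \<open>a \<noteq> \<zero>\<close> a_closed w by simp
  have "coprime r (q - 1)"
    using prime_r r_ndvd by (simp add: prime_imp_coprime)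
  then obtain x y where "r * x = (q - 1) * y + 1"
    using bezout_nat[of r "q - 1"] r_pos by auto
  then have "w [^] (r * x) = w [^] ((q - 1) * y) \<otimes> w"
    by simp
  then have "(w [^] r) [^] x = (w [^] (q - 1)) [^] y \<otimes> w"
    by (simp only: nat_pow_pow[OF w])
  then have w1: "w = \<one>"
    using w unfolding w_r w_q1 by simp
  then have "?b = a" using ba a_closed unfolding w_def by simp
  \<comment> \<open>For \<open>0 < m < r\<close>, an element fixed by the \<open>m\<close>-th
    Frobenius power lies in \<open>F\<close>.\<close>
  then have "m = 0"
    using frob_fixed_imp_mem[OF a_closed] coprime_less[of m] m a_notin by blast
  then have H_M: "H (M l i) = M (l \<otimes> nrm k i) i" if "l \<in> carrier L" "i < r" for l i
  proof -
    have "M l i = M l 0 \<otimes>\<^bsub>A\<^esub> M \<one> i"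
      using M_mult_M[of l \<one> 0 i] that r_pos by simp
    then have "H (M l i) = M l 0 \<otimes>\<^bsub>A\<^esub> M (nrm k i) i"
      using H_pow Hm \<open>m = 0\<close> that by (simp add: H_mult)
    also have "\<dots> = M (l \<otimes> nrm k i) i"
      using M_mult_M[of l "nrm k i" 0 i] that r_pos k by simp
    finally show ?thesis .
  qed
  have "H x = twist k x" if x: "x \<in> carrier A" for x
  proof -
    \<comment> \<open>The truncations \<open>c n\<close> add one monomial at a time, so additivity
      extends \<open>H_M\<close> to all of \<open>x\<close>.\<close>
    define c where "c n = (\<lambda>i\<in>{..<r}. if i < n then x i else \<zero>)" for n
    have c: "c n \<in> carrier A" for n using x by (auto simp: c_def carrier_A)
    have c_apply: "c n i = (if i < n then x i else \<zero>)" if "i < r" for n i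
      using that by (simp add: c_def)
    have "H (c n) = twist k (c n)" if "n \<le> r" for n
      using that
    proof (induction n)
      case 0
      have "c 0 = M \<zero> 0"
        by (rule A_eqI[OF c M_closed]) (simp_all add: c_apply M_apply)
      moreover have "M (\<zero> \<otimes> nrm k 0) 0 = twist k (M \<zero> 0)"
        using k by (intro A_eqI twist_closed M_closed) (simp_all add: twist_apply M_apply)
      ultimately show ?case using H_M[OF zero_closed r_pos] by simp
    next
      case (Suc n)
      have xn: "x n \<in> carrier L" using x Suc.prems by simp
      have split: "c (Suc n) = c n \<oplus>\<^bsub>A\<^esub> M (x n) n"
        using x xn by (intro A_eqI add_closed_A c M_closed)
          (auto simp: add_A c_apply M_apply less_Suc_eq)
      have "H (c (Suc n)) = twist k (c n) \<oplus>\<^bsub>A\<^esub> M (x n \<otimes> nrm k n) n"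
        unfolding split using Suc H_M[OF xn, of n] c xn by (simp add: H_add)
      also have "\<dots> = twist k (c (Suc n))"
        using x xn c k by (intro A_eqI add_closed_A twist_closed c M_closed)
          (auto simp: add_A twist_apply c_apply M_apply less_Suc_eq)
      finally show ?case .
    qed
    moreover have "c r = x" by (rule A_eqI[OF c x]) (simp add: c_def)
    ultimately show ?thesis by (metis order_refl)
  qed
  moreover have "H \<in> extensional (carrier A)"
    using H by (simp add: alg_aut_group_def Bij_def)
  ultimately have "H = twist k"
    by (intro extensionalityI[of _ "carrier A"]) (auto simp: twist_def)
  then show ?thesis using k w1 unfolding w_def by blast
qed

end

section \<open>The elements of norm one form a cyclic group\<close>

lemma aut_group_iso: "alg_aut_group F A \<cong> integer_mod_group (\<Sum>i<r. q ^ i)"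
proof -
  define s where "s = (\<Sum>i<r. q ^ i)"
  have s_pos: "s > 0" unfolding s_def using r_pos q_gt_1 by (intro sum_pos) auto
  have qs: "(q - 1) * s = q ^ r - 1" unfolding s_def by (rule geometric_sum_nat)
  obtain g where g: "g \<in> carrier L - {\<zero>}"
    and gen: "\<And>x. x \<in> carrier L - {\<zero>} \<Longrightarrow> \<exists>i::nat. x = g [^] i"
    and ord: "\<And>n::nat. g [^] n = \<one> \<longleftrightarrow> (q ^ r - 1) dvd n"
    using finite_mult_generator[OF finite_L] card_L by metis
  \<comment> \<open>\<open>g\<close> has order \<open>(q - 1) * s\<close>, so \<open>h\<close> has
    order \<open>s\<close>; its powers are the elements of norm one.\<close>
  define h where "h = g [^] (q - 1)"
  have h: "h \<in> carrier L" using g by (simp add: h_def)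
  have h_ord: "h [^] n = \<one> \<longleftrightarrow> s dvd n" for n
    using g ord[of "(q - 1) * n", folded qs] q_gt_1 by (simp add: h_def nat_pow_pow)
  have nrm: "nrm x r = x [^] s" if "x \<in> carrier L" for x
    using nrm_r[OF that] by (simp add: s_def)
  have h_norm: "nrm (h [^] n) r = \<one>" for n :: nat
    using h h_ord[of "n * s"] by (simp add: nrm nat_pow_pow)
  have h_mod: "h [^] (n mod s) = h [^] n" for n
  proof -
    have "h [^] n = h [^] (s * (n div s) + n mod s)" by simp
    also have "\<dots> = h [^] (s * (n div s)) \<otimes> h [^] (n mod s)"
      by (rule nat_pow_mult[OF h, symmetric])
    also have "\<dots> = h [^] (n mod s)"
      using h h_ord[of "s * (n div s)"] by simp
    finally show ?thesis ..
  qed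
  let ?Z = "integer_mod_group s"
  \<comment> \<open>The carrier of \<open>?Z\<close> consists of the integers from 0 to
    \<open>s - 1\<close>, so \<open>nat\<close> loses nothing there.\<close>
  let ?f = "\<lambda>z. twist (h [^] nat z)"
  have Z: "carrier ?Z = {0..<int s}" using s_pos by (simp add: carrier_integer_mod_group)
  have "?f \<in> iso ?Z (alg_aut_group F A)"
  proof (rule isoI)
    show "?f \<in> hom ?Z (alg_aut_group F A)"
    proof (rule homI)
      fix x y assume xy: "x \<in> carrier ?Z" "y \<in> carrier ?Z"
      have "nat ((x + y) mod int s) = (nat x + nat y) mod s"
        using xy unfolding Z by (simp add: nat_mod_distrib nat_add_distrib)
      then show "?f (x \<otimes>\<^bsub>?Z\<^esub> y) = ?f x \<otimes>\<^bsub>alg_aut_group F A\<^esub> ?f y"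
        using h h_norm by (simp add: twist_compose h_mod nat_pow_mult)
    qed (use h h_norm twist_in_aut in simp)
    have "inj_on ?f (carrier ?Z)"
    proof (rule linorder_inj_onI)
      fix x y assume xy: "x < y" "x \<in> carrier ?Z" "y \<in> carrier ?Z"
      show "?f x \<noteq> ?f y"
      proof
        assume "?f x = ?f y"
        then have "h [^] nat x = h [^] nat y" using twist_inj h by blast
        moreover have "nat x + (nat y - nat x) = nat y" using xy unfolding Z by simp
        then have "h [^] nat y = h [^] nat x \<otimes> h [^] (nat y - nat x)"
          by (simp only: nat_pow_mult[OF h])
        ultimately have "h [^] nat x \<otimes> h [^] (nat y - nat x) = h [^] nat x \<otimes> \<one>"
          using h by simp
        \<comment> \<open>Zero has norm zero, whereas powers of \<open>h\<close> have norm
          one.\<close>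
        moreover have "h [^] nat x \<noteq> \<zero>"
          using h_norm[of "nat x"] h nrm[of "h [^] nat x"] s_pos by (auto simp: nat_pow_zero)
        ultimately have "h [^] (nat y - nat x) = \<one>"
          using h m_lcancel by blast
        then have "s dvd nat y - nat x" by (simp add: h_ord)
        then show False using xy unfolding Z by (auto dest: dvd_imp_le)
      qed
    qed auto
    moreover have "?f ` carrier ?Z = carrier (alg_aut_group F A)"
    proof
      show "?f ` carrier ?Z \<subseteq> carrier (alg_aut_group F A)"
        using h h_norm twist_in_aut by auto
      show "carrier (alg_aut_group F A) \<subseteq> ?f ` carrier ?Z"
      proof
        fix H assume "H \<in> carrier (alg_aut_group F A)"
        then obtain k where k: "k \<in> carrier L" "nrm k r = \<one>" "H = twist k"
          using aut_eq_twist by blast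
        have ks: "k [^] s = \<one>" using nrm k by simp
        then have "k \<noteq> \<zero>" using s_pos by (auto simp: nat_pow_zero)
        then obtain i where i: "k = g [^] (i::nat)" using gen k(1) by blast
        have "g [^] (i * s) = \<one>" using ks g i by (simp add: nat_pow_pow)
        \<comment> \<open>Cancelling \<open>s\<close> shows that \<open>q - 1\<close> divides
          \<open>i\<close>, so \<open>k\<close> is a power of \<open>h\<close>.\<close>
        then have "(q - 1) * s dvd i * s" unfolding qs using ord by blast
        then obtain j where "i = (q - 1) * j" using s_pos by auto
        then have "k = h [^] j" using i g by (simp add: h_def nat_pow_pow)
        then have "H = ?f (int (j mod s))" using k(3) by (simp add: h_mod)
        moreover have "int (j mod s) \<in> carrier ?Z" unfolding Z using s_pos by simp
        ultimately show "H \<in> ?f ` carrier ?Z" by blast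
      qed
    qed
    ultimately show "bij_betw ?f (carrier ?Z) (carrier (alg_aut_group F A))"
      by (simp add: bij_betw_def)
  qed
  then show ?thesis
    unfolding s_def[symmetric] by (rule group.iso_sym[OF group_integer_mod_group is_isoI])
qed

end

theorem corollary3p8:
  fixes L :: "('a, 'b) ring_scheme" and F :: "'a set" and q r :: nat
    and \<sigma> :: "'a \<Rightarrow> 'a" and a :: 'a
  assumes "field L" and "subfield F L"
    and "primepow q" and "card F = q"
    and "Factorial_Ring.prime r" and "ring.dimension L r F (carrier L)"
    and "\<sigma> \<in> carrier (galois_group L F)"
    and "generate (galois_group L F) {\<sigma>} = carrier (galois_group L F)"
    and "\<not> r dvd (q - 1)"
    and "a \<in> carrier L - F"
  shows "alg_aut_group F (nonassoc_cyclic_algebra L F \<sigma> a)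
           \<cong> integer_mod_group ((q ^ r - 1) div (q - 1))"
proof -
  interpret field L by (rule assms(1))
  interpret finite_field_ext L F q r
    by (intro finite_field_ext.intro finite_field_ext_axioms.intro assms prime_gt_1_nat)
  obtain e where "0 < e" "e < r" "\<And>x. x \<in> carrier L \<Longrightarrow> \<sigma> x = x [^]\<^bsub>L\<^esub> (q ^ e)"
    using galois_generator_frob[OF assms(7,8)] by blast
  then interpret finite_cyclic_algebra L F q r \<sigma> e a
    by (intro finite_cyclic_algebra.intro finite_cyclic_algebra_axioms.intro
        finite_field_ext_axioms assms(5,9,10))
  \<comment> \<open>The quotient is exact by the geometric sum identity.\<close>
  have "(q ^ r - 1) div (q - 1) = (\<Sum>i<r. q ^ i)"
    unfolding geometric_sum_nat[symmetric, of q r] using q_gt_1 by simp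
  then show ?thesis using aut_group_iso by simp
qed

end
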